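(* Let $X,Y,Z$ be Riesz spaces with net convergence structures connected by a bilinear product, $\mathcal H$ a $\sigma$-algebra of subsets of $\Omega$, and let $Z$ be Dedekind complete and weakly $\sigma$-distributive. Let $\mu:\mathcal H\to Y^+$ be $\sigma$-additive and let $\{f_n\}_{n\in\mathbb N}$ be a sequence of nonnegative functions $f_n:\Omega\to X$ that are $S^*$-partition integrable on $\Omega$ with respect to $\mu$. If $f_n$ converges uniformly almost everywhere in order to a nonnegative function $f:\Omega\to X$, then $f$ is $S^*$-partition integrable on $\Omega$ and $$\int_\Omega^{S^*}f_n\,d\mu\xrightarrow{\ o\ }\int_\Omega^{S^*}f\,d\mu$$ (order convergence in $Z$).
   Context: A net convergence structure $\eta$ on a set $V$ assigns to each $v\in V$ a class of nets in $V$ ("converging to $v$") such that: (i) constant nets $v$ converge to $v$; (ii) every quasi-subnet of a net converging to $v$ converges to $v$, where $(y_j)_{j\in J}$ is a quasi-subnet of $(x_i)_{i\in I}$ if for every $i_0$ there is $j_0$ with $\{y_j:j\ge j_0\}\subseteq\{x_i:i\ge i_0\}$; (iii) if $(x_i)_{i\in I},(y_i)_{i\in I}$ converge to $v$ and $z_i\in\{x_i,y_i\}$ for all $i$, then $(z_i)$ converges to $v$. Standing assumptions: real vector spaces, Archimedean Riesz spaces, Hausdorff structures (unique limits), continuous addition and multiplication by fixed reals; on Riesz spaces the structure is locally solid: if $y_l\to0$ and $(x_i)$ is a net such that for every $l_0$ there is $i_0$ such that for every $i\ge i_0$ there is $l\ge l_0$ with $|x_i|\le|y_l|$, then $x_i\to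 0$. The bilinear product $\bullet:X\times Y\to Z$ (juxtaposition) is a bilinear map, continuous in each argument separately, isotone on $X^+\times Y^+$, with $\sup_n(x_n\bullet y)=(\sup_n x_n)\bullet y$ and $\sup_n(x\bullet y_n)=x\bullet(\sup_n y_n)$ for $x\in X^+$, $y\in Y^+$ and nonnegative sequences whose suprema exist. A $(D)$-sequence is a double sequence $\{a_{ij}\}$ with $a_{ij}\ge a_{i,j+1}$ and $\bigwedge_j a_{ij}=0$ for all $i$. A net $(x_i)$ $(D)$-converges to $x$ if there is a $(D)$-sequence such that for every $\varphi\in\mathbb N^{\mathbb N}$ there is $i_0$ with $|x_i-x|\le\bigvee_{j}a_{j\varphi(j)}$ for $i\ge i_0$ (suprema understood to exist, $(D)$-sequences being bounded). $Z$ is weakly $\sigma$-distributive if $\bigwedge_{\varphi}\bigvee_i a_{i\varphi(i)}=0$ for every $(D)$-sequence; Dedekind complete if every set bounded above has a supremum. A net $(x_i)$ in a Riesz space order converges to $x$ if there is a net $y_d\downarrow0$ such that for every $d$ there is $i^*$ with $|x_i-x|\le y_d$ for $i\ge i^*$. A family is unconditionally summable to $z$ if the net of its finite sums, indexed by finite index subsets ordered by inclusion, converges to $z$. $\mu:\mathcal H\to Y$ is $\sigma$-additive if $\mu(\bigcup_n A_n)$ is the unconditional sum (in $\eta_2$) of $\{\mu(A_n)\}$ for disjoint $A_n\in\mathcal H$ with union in $\mathcal H$. $S^*$-partition integral on $A\in\mathcal H$: let $\mathcal P(A)$ be the set of countable partitions of $A$ into nonempty sets of $\mathcal H$, ordered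 by refinement ($P\le Q$ iff every member of $Q$ is contained in a member of $P$). A choice function $\delta$ selects $\delta_\alpha\in\alpha$ for every nonempty $\alpha\subseteq\Omega$. $f:\Omega\to X$ is $S^*$-partition integrable on $A$ with integral $\int_A^{S^*}f\,d\mu=z\in Z$ if there is $P_*\in\mathcal P(A)$ such that for all $P\ge P_*$ and all $\delta$ the series $\sum_{\alpha\in P}f(\delta_\alpha)\mu(\alpha)$ converges unconditionally in $Z$ (in order), and these sums $(D)$-converge to $z$ along refinement, independently of $\delta$: there is a $(D)$-sequence $\{a_{ij}\}$ in $Z$ such that for every $\varphi$ there is $P_0$ with $|\sum_{\alpha\in P}f(\delta_\alpha)\mu(\alpha)-z|\le\bigvee_i a_{i\varphi(i)}$ for all $P\ge P_0$ and all $\delta$. $f_n\to f$ uniformly almost everywhere in order if there are $N\in\mathcal H$ with $\mu(N)=0$ and a non-increasing sequence $u_n\downarrow0$ in $X$ with $|f_n(\omega)-f(\omega)|\le u_n$ for all $\omega\in\Omega\setminus N$ and all $n$. *)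

theory Defs
  imports
    "HOL-Analysis.Analysis"
    "HOL-Library.Lattice_Algebras"
    "HOL-Library.Lub_Glb"
    "HOL-Library.Disjoint_Sets"
    "HOL-Library.Infinite_Typeclass"
begin

section \<open>Riesz spaces\<close>

class riesz_space = ordered_real_vector + lattice_ab_group_add_abs

class archimedean_riesz_space = riesz_space +
  assumes archimedean: "0 \<le> x \<Longrightarrow> (\<And>n::nat. real n *\<^sub>R x \<le> y) \<Longrightarrow> x = 0"

instance real :: riesz_space ..

instance real :: archimedean_riesz_space
proof
  fix x y :: real
  assume "0 \<le> x" and *: "real n *\<^sub>R x \<le> y" for n
  show "x = 0"
  proof (rule ccontr)
    assume "x \<noteq> 0"
    with \<open>0 \<le> x\<close> have "0 < x" by simp
    then obtain n where "y < real n * x" using reals_Archimedean3 by blast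
    with * [of n] show False by simp
  qed
qed

text \<open>
  Dedekind completeness of a Riesz space is expressed by the additional class
  \<open>conditionally_complete_lattice\<close>, and \<open>SUP\<close> is only used for bounded families in such
  spaces. In a general Riesz space, suprema and infima that need not exist are expressed by
  \<open>isLub UNIV\<close> and \<open>isGlb UNIV\<close>.
\<close>

section \<open>Nets\<close>

text \<open>
  A net consists of a directed index set \<open>I\<close> (a subset of an index type), a preorder
  \<open>le\<close> on it, and a function \<open>x\<close>, of which only the values on \<open>I\<close> matter.
\<close>

definition directed_set :: "'i set \<Rightarrow> ('i \<Rightarrow> 'i \<Rightarrow> bool) \<Rightarrow> bool" where
  "directed_set I le \<longleftrightarrow> I \<noteq> {} \<and> reflp_on I le \<and> transp_on I le \<and>
     (\<forall>i\<in>I. \<forall>j\<in>I. \<exists>k\<in>I. le i k \<and> le j k)"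

definition quasi_subnet ::
  "'j set \<Rightarrow> ('j \<Rightarrow> 'j \<Rightarrow> bool) \<Rightarrow> ('j \<Rightarrow> 'v) \<Rightarrow>
   'i set \<Rightarrow> ('i \<Rightarrow> 'i \<Rightarrow> bool) \<Rightarrow> ('i \<Rightarrow> 'v) \<Rightarrow> bool" where
  "quasi_subnet J leJ y I leI x \<longleftrightarrow>
     (\<forall>i0\<in>I. \<exists>j0\<in>J. y ` {j\<in>J. leJ j0 j} \<subseteq> x ` {i\<in>I. leI i0 i})"

section \<open>Net convergence structures\<close>

text \<open>
  In HOL one cannot quantify over nets of all index types inside a formula, so a net convergence
  structure is given on the nets whose index sets are subsets of a type \<open>'i\<close>, the universe of
  indices. The universe is a type variable; it can be taken as large as one likes, and every net
  in a space of type \<open>'v\<close> has the same tails as one indexed by a subset of \<open>'v set \<times> 'v\<close>.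
\<close>

type_synonym ('i, 'v) net_convergence =
  "'i set \<Rightarrow> ('i \<Rightarrow> 'i \<Rightarrow> bool) \<Rightarrow> ('i \<Rightarrow> 'v) \<Rightarrow> 'v \<Rightarrow> bool"

locale net_convergence_structure =
  fixes \<eta> :: "('i, 'v) net_convergence"
  assumes net: "\<eta> I le x v \<Longrightarrow> directed_set I le"
    and const: "directed_set I le \<Longrightarrow> \<eta> I le (\<lambda>_. v) v"
    and subnet: "\<lbrakk>\<eta> I le x v; directed_set J leJ; quasi_subnet J leJ y I le x\<rbrakk> \<Longrightarrow> \<eta> J leJ y v"
    and mix: "\<lbrakk>\<eta> I le x v; \<eta> I le y v; \<And>i. i \<in> I \<Longrightarrow> z i \<in> {x i, y i}\<rbrakk> \<Longrightarrow> \<eta> I le z v"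

locale hausdorff_vector_convergence = net_convergence_structure \<eta>
  for \<eta> :: "('i, 'v::real_vector) net_convergence" +
  assumes hausdorff: "\<lbrakk>\<eta> I le x v; \<eta> I le x w\<rbrakk> \<Longrightarrow> v = w"
    and add: "\<lbrakk>\<eta> I le x v; \<eta> I le y w\<rbrakk> \<Longrightarrow> \<eta> I le (\<lambda>i. x i + y i) (v + w)"
    and scale: "\<eta> I le x v \<Longrightarrow> \<eta> I le (\<lambda>i. r *\<^sub>R x i) (r *\<^sub>R v)"

locale locally_solid_convergence = hausdorff_vector_convergence \<eta>
  for \<eta> :: "('i, 'v::archimedean_riesz_space) net_convergence" +
  assumes locally_solid:
    "\<lbrakk>\<eta> L leL y 0; directed_set I le;
      \<forall>l0\<in>L. \<exists>i0\<in>I. \<forall>i\<in>I. le i0 i \<longrightarrow> (\<exists>l\<in>L. leL l0 l \<and> \<bar>x i\<bar> \<le> \<bar>y l\<bar>)\<rbrakk>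
     \<Longrightarrow> \<eta> I le x 0"

text \<open>
  Convergence of a net over a foreign index type \<open>'j\<close>: being a quasi-subnet of a convergent net
  of the universe. By the quasi-subnet axiom no other reading is possible when the index set
  embeds into \<open>'i\<close>, and for \<open>'j = 'i\<close> this is \<open>\<eta>\<close> itself.
\<close>

definition converges_in ::
  "('i, 'v) net_convergence \<Rightarrow> 'j set \<Rightarrow> ('j \<Rightarrow> 'j \<Rightarrow> bool) \<Rightarrow> ('j \<Rightarrow> 'v) \<Rightarrow> 'v \<Rightarrow> bool" where
  "converges_in \<eta> J leJ y v \<longleftrightarrow>
     directed_set J leJ \<and> (\<exists>I le x. \<eta> I le x v \<and> quasi_subnet J leJ y I le x)"

definition unconditional_sum ::
  "('i, 'v::comm_monoid_add) net_convergence \<Rightarrow> ('k \<Rightarrow> 'v) \<Rightarrow> 'k set \<Rightarrow> 'v \<Rightarrow> bool" where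
  "unconditional_sum \<eta> g K s \<longleftrightarrow> converges_in \<eta> {F. finite F \<and> F \<subseteq> K} (\<subseteq>) (sum g) s"

locale bilinear_product =
  fixes \<eta>1 :: "('i, 'x::riesz_space) net_convergence"
    and \<eta>2 :: "('i, 'y::riesz_space) net_convergence"
    and \<eta>3 :: "('i, 'z::riesz_space) net_convergence"
    and bprod :: "'x \<Rightarrow> 'y \<Rightarrow> 'z"
  assumes bilinear: "bilinear bprod"
    and continuous_left: "\<eta>1 I le x d \<Longrightarrow> \<eta>3 I le (\<lambda>i. bprod (x i) b) (bprod d b)"
    and continuous_right: "\<eta>2 I le y c \<Longrightarrow> \<eta>3 I le (\<lambda>i. bprod a (y i)) (bprod a c)"
    and isotone: "\<lbrakk>0 \<le> a; a \<le> a'; 0 \<le> b; b \<le> b'\<rbrakk> \<Longrightarrow> bprod a b \<le> bprod a' b'"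
    and sup_left: "\<lbrakk>0 \<le> b; \<And>n::nat. 0 \<le> u n; isLub UNIV (range u) s\<rbrakk>
      \<Longrightarrow> isLub UNIV (range (\<lambda>n. bprod (u n) b)) (bprod s b)"
    and sup_right: "\<lbrakk>0 \<le> a; \<And>n::nat. 0 \<le> w n; isLub UNIV (range w) t\<rbrakk>
      \<Longrightarrow> isLub UNIV (range (\<lambda>n. bprod a (w n))) (bprod a t)"

section \<open>Order convergence and (D)-sequences\<close>

text \<open>
  The dominating net \<open>y\<close> decreasing to \<open>0\<close> may have any index set. Taking that set inside the
  space itself is no restriction: a decreasing net can be replaced by its set of values, indexed
  by itself with the reversed order.
\<close>

definition order_converges ::
  "'i set \<Rightarrow> ('i \<Rightarrow> 'i \<Rightarrow> bool) \<Rightarrow> ('i \<Rightarrow> 'v::riesz_space) \<Rightarrow> 'v \<Rightarrow> bool" where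
  "order_converges I le x v \<longleftrightarrow> directed_set I le \<and>
     (\<exists>(D::'v set) leD y. directed_set D leD \<and>
        (\<forall>d\<in>D. \<forall>d'\<in>D. leD d d' \<longrightarrow> y d' \<le> y d) \<and> isGlb UNIV (y ` D) 0 \<and>
        (\<forall>d\<in>D. \<exists>i0\<in>I. \<forall>i\<in>I. le i0 i \<longrightarrow> \<bar>x i - v\<bar> \<le> y d))"

definition has_order_sum :: "('k \<Rightarrow> 'v::riesz_space) \<Rightarrow> 'k set \<Rightarrow> 'v \<Rightarrow> bool" where
  "has_order_sum g K s \<longleftrightarrow> order_converges {F. finite F \<and> F \<subseteq> K} (\<subseteq>) (sum g) s"

definition order_sum :: "('k \<Rightarrow> 'v::riesz_space) \<Rightarrow> 'k set \<Rightarrow> 'v" where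
  "order_sum g K = (THE s. has_order_sum g K s)"

definition D_sequence :: "(nat \<Rightarrow> nat \<Rightarrow> 'v::riesz_space) \<Rightarrow> bool" where
  "D_sequence a \<longleftrightarrow> (\<forall>i. decseq (a i)) \<and> (\<forall>i. isGlb UNIV (range (a i)) 0) \<and>
     (\<exists>M. \<forall>i j. \<bar>a i j\<bar> \<le> M)"

definition weakly_sigma_distributive ::
  "'z::{riesz_space, conditionally_complete_lattice} itself \<Rightarrow> bool" where
  "weakly_sigma_distributive _ \<longleftrightarrow>
     (\<forall>a :: nat \<Rightarrow> nat \<Rightarrow> 'z. D_sequence a \<longrightarrow>
        isGlb UNIV (range (\<lambda>\<phi>::nat \<Rightarrow> nat. SUP i. a i (\<phi> i))) 0)"

section \<open>Measures and the \<open>S\<^sup>*\<close>-partition integral\<close>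

definition sigma_additive ::
  "('i, 'y::riesz_space) net_convergence \<Rightarrow> 'w set set \<Rightarrow> ('w set \<Rightarrow> 'y) \<Rightarrow> bool" where
  "sigma_additive \<eta> H \<mu> \<longleftrightarrow>
     (\<forall>A :: nat \<Rightarrow> 'w set. range A \<subseteq> H \<longrightarrow> disjoint_family A \<longrightarrow> (\<Union>n. A n) \<in> H \<longrightarrow>
        unconditional_sum \<eta> (\<lambda>n. \<mu> (A n)) UNIV (\<mu> (\<Union>n. A n)))"

definition countable_partitions :: "'w set set \<Rightarrow> 'w set \<Rightarrow> 'w set set set" where
  "countable_partitions H A = {P. partition_on A P \<and> P \<subseteq> H \<and> countable P}"

definition refined_by :: "'w set set \<Rightarrow> 'w set set \<Rightarrow> bool" where
  "refined_by P Q \<longleftrightarrow> (\<forall>\<beta>\<in>Q. \<exists>\<alpha>\<in>P. \<beta> \<subseteq> \<alpha>)"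

definition choice_function :: "'w set \<Rightarrow> ('w set \<Rightarrow> 'w) \<Rightarrow> bool" where
  "choice_function \<Omega> \<delta> \<longleftrightarrow> (\<forall>\<alpha>. \<alpha> \<noteq> {} \<longrightarrow> \<alpha> \<subseteq> \<Omega> \<longrightarrow> \<delta> \<alpha> \<in> \<alpha>)"

text \<open>
  The sums are defined for \<open>P\<close> beyond \<open>P\<^sub>*\<close>, so the net of sums is the one indexed by these
  partitions; accordingly \<open>P0\<close> is taken beyond \<open>P\<^sub>*\<close>.
\<close>

definition has_Sstar_integral ::
  "('x \<Rightarrow> 'y \<Rightarrow> 'z::{riesz_space, conditionally_complete_lattice}) \<Rightarrow>
   'w set \<Rightarrow> 'w set set \<Rightarrow> ('w set \<Rightarrow> 'y) \<Rightarrow> 'w set \<Rightarrow> ('w \<Rightarrow> 'x) \<Rightarrow> 'z \<Rightarrow> bool" where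
  "has_Sstar_integral bprod \<Omega> H \<mu> A f z \<longleftrightarrow>
     (\<exists>Ps\<in>countable_partitions H A.
        (\<forall>P\<in>countable_partitions H A. refined_by Ps P \<longrightarrow>
           (\<forall>\<delta>. choice_function \<Omega> \<delta> \<longrightarrow>
              (\<exists>s. has_order_sum (\<lambda>\<alpha>. bprod (f (\<delta> \<alpha>)) (\<mu> \<alpha>)) P s))) \<and>
        (\<exists>a. D_sequence a \<and>
           (\<forall>\<phi>::nat \<Rightarrow> nat. \<exists>P0\<in>countable_partitions H A. refined_by Ps P0 \<and>
              (\<forall>P\<in>countable_partitions H A. refined_by P0 P \<longrightarrow>
                 (\<forall>\<delta>. choice_function \<Omega> \<delta> \<longrightarrow>
                    \<bar>order_sum (\<lambda>\<alpha>. bprod (f (\<delta> \<alpha>)) (\<mu> \<alpha>)) P - z\<bar> \<le> (SUP i. a i (\<phi> i)))))))"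

definition Sstar_integrable ::
  "('x \<Rightarrow> 'y \<Rightarrow> 'z::{riesz_space, conditionally_complete_lattice}) \<Rightarrow>
   'w set \<Rightarrow> 'w set set \<Rightarrow> ('w set \<Rightarrow> 'y) \<Rightarrow> 'w set \<Rightarrow> ('w \<Rightarrow> 'x) \<Rightarrow> bool" where
  "Sstar_integrable bprod \<Omega> H \<mu> A f \<longleftrightarrow> (\<exists>z. has_Sstar_integral bprod \<Omega> H \<mu> A f z)"

definition Sstar_integral ::
  "('x \<Rightarrow> 'y \<Rightarrow> 'z::{riesz_space, conditionally_complete_lattice}) \<Rightarrow>
   'w set \<Rightarrow> 'w set set \<Rightarrow> ('w set \<Rightarrow> 'y) \<Rightarrow> 'w set \<Rightarrow> ('w \<Rightarrow> 'x) \<Rightarrow> 'z" where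
  "Sstar_integral bprod \<Omega> H \<mu> A f = (THE z. has_Sstar_integral bprod \<Omega> H \<mu> A f z)"

definition uniformly_ae_in_order ::
  "'w set \<Rightarrow> 'w set set \<Rightarrow> ('w set \<Rightarrow> 'y::zero) \<Rightarrow>
   (nat \<Rightarrow> 'w \<Rightarrow> 'x::riesz_space) \<Rightarrow> ('w \<Rightarrow> 'x) \<Rightarrow> bool" where
  "uniformly_ae_in_order \<Omega> H \<mu> f g \<longleftrightarrow>
     (\<exists>N\<in>H. \<mu> N = 0 \<and>
        (\<exists>u. decseq u \<and> isGlb UNIV (range u) 0 \<and>
           (\<forall>\<omega>\<in>\<Omega> - N. \<forall>n. \<bar>f n \<omega> - g \<omega>\<bar> \<le> u n)))"

end

theory Submission
  imports Defs
begin

text \<open>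
  Put \<open>v n = u n \<mu>(\<Omega>)\<close>, where \<open>u\<close> decreases to \<open>0\<close> and dominates \<open>f n - g\<close> outside a null set \<open>N\<close>. As the
  product respects monotone limits, \<open>v\<close> decreases to \<open>0\<close>. For a partition \<open>P\<close> that is split along \<open>N\<close>, the
  Riemann sums of \<open>f n\<close> and \<open>g\<close> over \<open>P\<close> with the same tags differ by at most \<open>v n\<close>: the
  partition elements inside \<open>N\<close> contribute nothing, and on the others the error is at most \<open>u n\<close> times the
  measures, whose finite sums are at most \<open>\<mu>(\<Omega>)\<close>. All terms are nonnegative, so that unconditional
  sums are suprema of finite sums and exist as soon as these are bounded (\<open>Riemann_sum_close\<close>).

  Weak \<open>\<sigma>\<close>-distributivity passes this to the integrals, \<open>\<bar>I m - I n\<bar> \<le> v m + v n\<close>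
  (\<open>integral_difference_le\<close>), and Dedekind completeness then gives a limit \<open>z\<close> with \<open>\<bar>I n - z\<bar> \<le> v n\<close>. It remains to
  see that \<open>z\<close> is the integral of \<open>g\<close>. The Riemann sums of \<open>g\<close> are within \<open>2 v n\<close> plus an error from the
  (D)-sequence of \<open>f n\<close> of \<open>z\<close>, for each \<open>n\<close>, and a single (D)-sequence has to control this. Since the case \<open>n = 0\<close>
  already bounds the distance to \<open>z\<close> by a fixed element \<open>w\<close>, all the (D)-sequences can be cut off at \<open>w\<close> and
  listed as rows of one bounded double sequence, together with one row for \<open>v\<close> whose column index selects
  \<open>n\<close> (\<open>D_sequence_merge\<close>).

  The bound \<open>\<mu>(\<Omega>)\<close> for finite sums of measures comes from positivity and finite additivity. Additivity and
  \<open>\<mu> {} = 0\<close> follow from uniqueness of limits, once nets indexed by finite sets of numbers are transported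
  into the universe of indices, which has room for them because it is infinite
  (\<open>sigma_additive_imp_additive\<close>).
\<close>

section \<open>Suprema and infima in Riesz spaces\<close>

lemma abs_diff_triangle:
  fixes a b c :: "'a::ordered_ab_group_add_abs"
  shows "\<bar>a - c\<bar> \<le> \<bar>a - b\<bar> + \<bar>b - c\<bar>"
  using abs_triangle_ineq[of "a - b" "b - c"] by simp

lemma isLub_UNIV_iff:
  "isLub UNIV A s \<longleftrightarrow> (\<forall>a\<in>A. a \<le> s) \<and> (\<forall>t. (\<forall>a\<in>A. a \<le> t) \<longrightarrow> s \<le> t)"
  by (auto simp: isLub_def leastP_def isUb_def setle_def setge_def)

lemma isGlb_UNIV_iff:
  "isGlb UNIV A s \<longleftrightarrow> (\<forall>a\<in>A. s \<le> a) \<and> (\<forall>t. (\<forall>a\<in>A. t \<le> a) \<longrightarrow> t \<le> s)"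
  by (auto simp: isGlb_def greatestP_def isLb_def setle_def setge_def)

text \<open>
  Allows an error term to be dropped from an estimate when it runs through a set with infimum \<open>0\<close>;
  there is no \<open>\<epsilon>\<close> to make small in a Riesz space, and this takes its place throughout.
\<close>

lemma isGlb_zero_absorb:
  fixes A :: "'a::ordered_ab_group_add set"
  assumes A: "isGlb UNIV A 0" and le: "\<And>a. a \<in> A \<Longrightarrow> x \<le> c + a"
  shows "x \<le> c"
proof -
  have "\<forall>a\<in>A. x - c \<le> a"
    using le by (simp add: diff_le_eq add.commute)
  then have "x - c \<le> 0"
    using A unfolding isGlb_UNIV_iff by blast
  then show ?thesis
    by simp
qed

text \<open>
  The reflection \<open>x \<mapsto> c - x\<close> exchanges suprema and infima. Its two uses are that errors \<open>s - S\<^sub>F\<close> of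
  partial sums of a nonnegative series have infimum \<open>0\<close>, and that a product which is continuous for
  increasing sequences is continuous for sequences decreasing to \<open>0\<close>.
\<close>

lemma isGlb_complement_iff:
  fixes x :: "'k \<Rightarrow> 'a::ordered_ab_group_add"
  shows "isGlb UNIV ((\<lambda>k. c - x k) ` A) 0 \<longleftrightarrow> isLub UNIV (x ` A) c"
proof
  assume glb: "isGlb UNIV ((\<lambda>k. c - x k) ` A) 0"
  have "c \<le> t" if t: "\<forall>k\<in>A. x k \<le> t" for t
  proof -
    have "\<forall>k\<in>A. c - t \<le> c - x k"
      using t by simp
    then have "c - t \<le> 0"
      using glb by (auto simp: isGlb_UNIV_iff simp del: diff_le_0_iff_le)
    then show ?thesis
      by simp
  qed
  then show "isLub UNIV (x ` A) c"
    using glb by (auto simp: isGlb_UNIV_iff isLub_UNIV_iff)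
next
  assume lub: "isLub UNIV (x ` A) c"
  have "t \<le> 0" if t: "\<forall>k\<in>A. t \<le> c - x k" for t
  proof -
    have "\<forall>k\<in>A. x k \<le> c - t"
      using t by (simp add: le_diff_eq add.commute)
    then have "c \<le> c - t"
      using lub by (auto simp: isLub_UNIV_iff simp del: le_diff_eq)
    then show ?thesis
      by simp
  qed
  then show "isGlb UNIV ((\<lambda>k. c - x k) ` A) 0"
    using lub by (auto simp: isGlb_UNIV_iff isLub_UNIV_iff)
qed

text \<open>
  Infinite distributivity, from \<open>a = inf w a + (sup w a - w)\<close>: bounding both summands
  uniformly bounds the supremum \<open>T\<close> of \<open>a\<close>, and the same identity for \<open>T\<close> turns that into the claim.
\<close>

lemma inf_le_SUP_inf:
  fixes a :: "'k \<Rightarrow> 'z::{lattice_ab_group_add, conditionally_complete_lattice}"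
  assumes bdd: "bdd_above (range a)"
  shows "inf w (SUP k. a k) \<le> (SUP k. inf w (a k))"
proof -
  let ?T = "SUP k. a k" and ?S = "SUP k. inf w (a k)"
  have bdd': "bdd_above (range (\<lambda>k. inf w (a k)))"
    by (rule bdd_aboveI[of _ w]) auto
  have "a k \<le> ?S + (sup w ?T - w)" for k
  proof -
    have "a k = inf w (a k) + (sup w (a k) - w)"
      using add_eq_inf_sup[of w "a k"] by (metis add.commute add_diff_cancel_left' add_diff_eq)
    also have "\<dots> \<le> ?S + (sup w ?T - w)"
      by (intro add_mono diff_right_mono sup_mono cSUP_upper bdd bdd') auto
    finally show ?thesis .
  qed
  then have "?T \<le> ?S + (sup w ?T - w)"
    by (intro cSUP_least) auto
  then have "w + ?T \<le> sup w ?T + ?S"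
    by (simp only: add_diff_eq le_diff_eq add.commute)
  then show ?thesis
    unfolding add_eq_inf_sup[of w ?T] by simp
qed

section \<open>Order convergence\<close>

text \<open>
  When the error bounds are indexed by the net itself, they are a decreasing net in the sense of
  \<^const>\<open>order_converges\<close> after passing to their set of values with the reversed order.
\<close>

lemma order_converges_if_dominated:
  fixes x e :: "'i \<Rightarrow> 'v::riesz_space"
  assumes dir: "directed_set I le"
    and anti: "\<And>i j. i \<in> I \<Longrightarrow> j \<in> I \<Longrightarrow> le i j \<Longrightarrow> e j \<le> e i"
    and glb: "isGlb UNIV (e ` I) 0"
    and le: "\<And>i. i \<in> I \<Longrightarrow> \<bar>x i - v\<bar> \<le> e i"
  shows "order_converges I le x v"
proof -
  have dirE: "directed_set (e ` I) (\<lambda>a b. b \<le> a)"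
    unfolding directed_set_def
  proof (intro conjI ballI)
    show "e ` I \<noteq> {}"
      using dir by (simp add: directed_set_def)
    show "reflp_on (e ` I) (\<lambda>a b. b \<le> a)" "transp_on (e ` I) (\<lambda>a b. b \<le> a)"
      by (auto simp: reflp_on_def transp_on_def)
    fix a b assume "a \<in> e ` I" "b \<in> e ` I"
    then obtain i j where ij: "i \<in> I" "a = e i" "j \<in> I" "b = e j"
      by blast
    then obtain k where "k \<in> I" "le i k" "le j k"
      using dir unfolding directed_set_def by meson
    then show "\<exists>c\<in>e ` I. c \<le> a \<and> c \<le> b"
      using ij anti by blast
  qed
  have "\<exists>i0\<in>I. \<forall>i\<in>I. le i0 i \<longrightarrow> \<bar>x i - v\<bar> \<le> e j" if "j \<in> I" for j
    using that by (intro bexI[of _ j]) (auto intro: order_trans[OF le anti])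
  then show ?thesis
    unfolding order_converges_def
    by (intro conjI dir exI[of _ "e ` I"] exI[of _ "\<lambda>a b. b \<le> a"] exI[of _ "\<lambda>a. a"] dirE)
       (use glb in auto)
qed

lemma order_converges_unique:
  fixes x :: "'i \<Rightarrow> 'v::riesz_space"
  assumes v: "order_converges I le x v" and w: "order_converges I le x w"
  shows "v = w"
proof -
  obtain D :: "'v set" and y where y: "isGlb UNIV (y ` D) 0"
      "\<forall>d\<in>D. \<exists>i0\<in>I. \<forall>i\<in>I. le i0 i \<longrightarrow> \<bar>x i - v\<bar> \<le> y d"
    using v unfolding order_converges_def by blast
  obtain E :: "'v set" and z where z: "isGlb UNIV (z ` E) 0"
      "\<forall>d\<in>E. \<exists>i0\<in>I. \<forall>i\<in>I. le i0 i \<longrightarrow> \<bar>x i - w\<bar> \<le> z d"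
    using w unfolding order_converges_def by blast
  have dir: "directed_set I le"
    using v by (simp add: order_converges_def)
  have "\<bar>v - w\<bar> \<le> y d + z e" if de: "d \<in> D" "e \<in> E" for d e
  proof -
    obtain i j where i: "i \<in> I" "\<forall>k\<in>I. le i k \<longrightarrow> \<bar>x k - v\<bar> \<le> y d"
      and j: "j \<in> I" "\<forall>k\<in>I. le j k \<longrightarrow> \<bar>x k - w\<bar> \<le> z e"
      using y(2) z(2) de by meson
    obtain k where k: "k \<in> I" "le i k" "le j k"
      using dir i(1) j(1) unfolding directed_set_def by meson
    have "\<bar>v - w\<bar> = \<bar>(v - x k) + (x k - w)\<bar>"
      by simp
    also have "\<dots> \<le> \<bar>v - x k\<bar> + \<bar>x k - w\<bar>"
      by (rule abs_triangle_ineq)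
    also have "\<dots> \<le> y d + z e"
      using i(2) j(2) k by (intro add_mono) (auto simp: abs_minus_commute)
    finally show ?thesis .
  qed
  then have sum_le: "\<bar>v - w\<bar> \<le> a + b" if "a \<in> y ` D" "b \<in> z ` E" for a b
    using that by auto
  have "\<bar>v - w\<bar> \<le> a" if "a \<in> y ` D" for a
    by (rule isGlb_zero_absorb[OF z(1) sum_le[OF that]])
  then have "\<bar>v - w\<bar> \<le> 0 + a" if "a \<in> y ` D" for a
    using that by simp
  then have "\<bar>v - w\<bar> \<le> 0"
    by (rule isGlb_zero_absorb[OF y(1)])
  then show ?thesis
    by simp
qed

section \<open>Series of nonnegative terms\<close>

lemma directed_set_finite_subsets: "directed_set {F. finite F \<and> F \<subseteq> K} (\<subseteq>)"
proof -
  have "\<exists>E\<in>{F. finite F \<and> F \<subseteq> K}. F \<subseteq> E \<and> G \<subseteq> E"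
    if "F \<in> {F. finite F \<and> F \<subseteq> K}" "G \<in> {F. finite F \<and> F \<subseteq> K}" for F G
    using that by (intro bexI[of _ "F \<union> G"]) auto
  then show ?thesis
    by (auto simp: directed_set_def reflp_on_def transp_on_def)
qed

text \<open>
  The finite sums of a nonnegative family increase, so a monotone net is all there is to study: its
  order limit and its supremum are the same thing. This replaces order convergence of series by
  inequalities between finite sums.
\<close>

lemma has_order_sum_nonneg_iff:
  fixes g :: "'k \<Rightarrow> 'v::riesz_space"
  assumes nonneg: "\<And>k. k \<in> K \<Longrightarrow> 0 \<le> g k"
  shows "has_order_sum g K s \<longleftrightarrow> isLub UNIV (sum g ` {F. finite F \<and> F \<subseteq> K}) s"
    (is "_ \<longleftrightarrow> isLub UNIV (sum g ` ?I) s")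
proof
  have mono: "sum g F \<le> sum g G" if "F \<in> ?I" "G \<in> ?I" "F \<subseteq> G" for F G
    using that nonneg by (intro sum_mono2) auto
  {
    assume "has_order_sum g K s"
    then obtain D :: "'v set" and y where y: "isGlb UNIV (y ` D) 0"
        "\<forall>d\<in>D. \<exists>F\<in>?I. \<forall>G\<in>?I. F \<subseteq> G \<longrightarrow> \<bar>sum g G - s\<bar> \<le> y d"
      unfolding has_order_sum_def order_converges_def by blast
    have upper: "sum g F \<le> s" if F: "F \<in> ?I" for F
    proof (rule isGlb_zero_absorb[OF y(1)])
      fix e assume "e \<in> y ` D"
      then obtain d where d: "d \<in> D" "e = y d"
        by (rule imageE)
      then obtain E where E: "E \<in> ?I" "\<forall>G\<in>?I. E \<subseteq> G \<longrightarrow> \<bar>sum g G - s\<bar> \<le> e"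
        using y(2) by meson
      have G: "E \<union> F \<in> ?I"
        using E F by auto
      have "sum g F \<le> sum g (E \<union> F)"
        by (rule mono[OF F G]) auto
      also have "\<dots> \<le> s + e"
        using abs_le_D1[of "sum g (E \<union> F) - s" e] E(2) G by (simp add: diff_le_eq add.commute)
      finally show "sum g F \<le> s + e" .
    qed
    have least: "s \<le> t" if t: "\<forall>F\<in>?I. sum g F \<le> t" for t
    proof (rule isGlb_zero_absorb[OF y(1)])
      fix e assume "e \<in> y ` D"
      then obtain d where d: "d \<in> D" "e = y d"
        by (rule imageE)
      then obtain E where E: "E \<in> ?I" "\<bar>sum g E - s\<bar> \<le> e"
        using y(2) by (meson order_refl)
      then have "s - sum g E \<le> e"
        using abs_le_D2[OF E(2)] by simp
      then have "s \<le> e + sum g E"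
        by (simp add: diff_le_eq)
      also have "\<dots> \<le> e + t"
        using t E(1) by simp
      finally show "s \<le> t + e"
        by (simp add: add.commute)
    qed
    show "isLub UNIV (sum g ` ?I) s"
      using upper least by (auto simp: isLub_UNIV_iff)
  }
  {
    assume lub: "isLub UNIV (sum g ` ?I) s"
    then have up: "sum g F \<le> s" if "F \<in> ?I" for F
      using that by (auto simp: isLub_UNIV_iff)
    have "isGlb UNIV ((\<lambda>F. s - sum g F) ` ?I) 0"
      using lub by (simp add: isGlb_complement_iff)
    moreover have "\<bar>sum g F - s\<bar> \<le> s - sum g F" if "F \<in> ?I" for F
      using up[OF that] by (simp add: abs_minus_commute)
    ultimately show "has_order_sum g K s"
      unfolding has_order_sum_def
      by (intro order_converges_if_dominated[where e = "\<lambda>F. s - sum g F"]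
          directed_set_finite_subsets) (use mono in auto)
  }
qed

lemma order_sum_eq: "has_order_sum g K s \<Longrightarrow> order_sum g K = s"
  unfolding order_sum_def
  unfolding has_order_sum_def by (rule the_equality) (blast dest: order_converges_unique)+

text \<open>
  Summability passes from \<open>q\<close> to \<open>p\<close> because the finite sums of \<open>p\<close> are bounded by \<open>s + c\<close> and
  suprema of bounded sets exist. The error family \<open>r\<close> enters through its finite sums, which for
  \<open>r \<alpha> = c \<mu>(\<alpha>)\<close> on a countable partition are controlled by finite additivity.
\<close>

lemma has_order_sum_comparison:
  fixes p q r :: "'k \<Rightarrow> 'z::{riesz_space, conditionally_complete_lattice}"
  assumes q: "has_order_sum q K s"
    and p_nonneg: "\<And>k. k \<in> K \<Longrightarrow> 0 \<le> p k" and q_nonneg: "\<And>k. k \<in> K \<Longrightarrow> 0 \<le> q k"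
    and pq: "\<And>k. k \<in> K \<Longrightarrow> p k \<le> q k + r k" and qp: "\<And>k. k \<in> K \<Longrightarrow> q k \<le> p k + r k"
    and r: "\<And>F. finite F \<Longrightarrow> F \<subseteq> K \<Longrightarrow> sum r F \<le> c"
  shows "\<exists>t. has_order_sum p K t \<and> \<bar>t - s\<bar> \<le> c"
proof -
  let ?I = "{F. finite F \<and> F \<subseteq> K}"
  have le: "sum h F \<le> l + c"
    if "F \<in> ?I" "\<And>k. k \<in> K \<Longrightarrow> h k \<le> h' k + r k" "sum h' F \<le> l"
    for h h' :: "'k \<Rightarrow> 'z" and l F
  proof -
    have "sum h F \<le> (\<Sum>k\<in>F. h' k + r k)"
      using that by (intro sum_mono) auto
    also have "\<dots> \<le> l + c"
      using that r[of F] by (simp add: sum.distrib add_mono)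
    finally show ?thesis .
  qed
  have s: "isLub UNIV (sum q ` ?I) s"
    using q has_order_sum_nonneg_iff[of K q s] q_nonneg by blast
  have p_le: "sum p F \<le> s + c" if "F \<in> ?I" for F
    using that s pq by (intro le[of F p q]) (auto simp: isLub_UNIV_iff)
  define t where "t = (SUP F\<in>?I. sum p F)"
  have bdd: "bdd_above (sum p ` ?I)"
    using p_le by (intro bdd_aboveI2[where M = "s + c"])
  have ne: "?I \<noteq> {}"
    by auto
  have t: "isLub UNIV (sum p ` ?I) t"
    unfolding isLub_UNIV_iff t_def
    using cSUP_upper[OF _ bdd] cSUP_least[OF ne, of "sum p"] by auto
  have "t \<le> s + c"
    using t p_le by (auto simp: isLub_UNIV_iff)
  moreover have "sum q F \<le> t + c" if "F \<in> ?I" for F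
    using that t qp by (intro le[of F q p]) (auto simp: isLub_UNIV_iff)
  then have "s \<le> t + c"
    using s by (auto simp: isLub_UNIV_iff)
  ultimately have "\<bar>t - s\<bar> \<le> c"
    by (intro abs_leI) (simp_all add: diff_le_eq add.commute)
  moreover have "has_order_sum p K t"
    using has_order_sum_nonneg_iff[of K p t] t p_nonneg by blast
  ultimately show ?thesis
    by blast
qed

section \<open>Finite additivity\<close>

text \<open>
  A limit of a net over a foreign index type is only witnessed by some net of the universe, and two
  limits may have witnesses over different index sets. Transporting the net along an injection into
  the universe gives one net that has both limits, so that uniqueness of limits and the vector
  operations become applicable.
\<close>

lemma (in net_convergence_structure) converges_in_pullback:
  fixes h :: "'j \<Rightarrow> 'i"
  assumes conv: "converges_in \<eta> J leJ y v" and inj: "inj_on h J"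
  defines "r \<equiv> inv_into J h"
  shows "\<eta> (h ` J) (\<lambda>a b. leJ (r a) (r b)) (\<lambda>a. y (r a)) v"
proof -
  have r: "r (h j) = j" if "j \<in> J" for j
    using that inj by (simp add: r_def)
  obtain I le x where x: "\<eta> I le x v" and sub: "quasi_subnet J leJ y I le x"
    and dir: "directed_set J leJ"
    using conv unfolding converges_in_def by blast
  have "directed_set (h ` J) (\<lambda>a b. leJ (r a) (r b))"
    unfolding directed_set_def
  proof (intro conjI)
    show "h ` J \<noteq> {}"
      using dir by (simp add: directed_set_def)
    show "reflp_on (h ` J) (\<lambda>a b. leJ (r a) (r b))"
      using dir by (auto simp: directed_set_def reflp_on_def r)
    show "transp_on (h ` J) (\<lambda>a b. leJ (r a) (r b))"
    proof (rule transp_onI)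
      fix a b c assume "a \<in> h ` J" "b \<in> h ` J" "c \<in> h ` J" "leJ (r a) (r b)" "leJ (r b) (r c)"
      moreover from this have "r a \<in> J" "r b \<in> J" "r c \<in> J"
        by (auto simp: r)
      ultimately show "leJ (r a) (r c)"
        using dir transp_onD unfolding directed_set_def by fast
    qed
    show "\<forall>a\<in>h ` J. \<forall>b\<in>h ` J. \<exists>c\<in>h ` J. leJ (r a) (r c) \<and> leJ (r b) (r c)"
      using dir unfolding directed_set_def by (simp add: r)
  qed
  moreover have "quasi_subnet (h ` J) (\<lambda>a b. leJ (r a) (r b)) (\<lambda>a. y (r a)) I le x"
    unfolding quasi_subnet_def
  proof
    fix i0 assume "i0 \<in> I"
    then obtain j0 where j0: "j0 \<in> J" "y ` {j \<in> J. leJ j0 j} \<subseteq> x ` {i \<in> I. le i0 i}"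
      using sub unfolding quasi_subnet_def by blast
    have "(\<lambda>a. y (r a)) ` {a \<in> h ` J. leJ (r (h j0)) (r a)} \<subseteq> y ` {j \<in> J. leJ j0 j}"
      using j0(1) by (auto simp: r)
    then show "\<exists>a0\<in>h ` J. (\<lambda>a. y (r a)) ` {a \<in> h ` J. leJ (r a0) (r a)} \<subseteq> x ` {i \<in> I. le i0 i}"
      using j0 by blast
  qed
  ultimately show ?thesis
    using subnet[OF x] by blast
qed

text \<open>
  A one-point index set carries the constant net, and a net that is eventually constant is a
  quasi-subnet of it.
\<close>

lemma (in net_convergence_structure) converges_in_eventually_const:
  assumes dir: "directed_set J leJ" and j0: "j0 \<in> J"
    and const_tail: "\<And>j. j \<in> J \<Longrightarrow> leJ j0 j \<Longrightarrow> y j = c"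
  shows "converges_in \<eta> J leJ y c"
proof -
  have "directed_set {undefined :: 'i} (\<lambda>_ _. True)"
    by (auto simp: directed_set_def reflp_on_def transp_on_def)
  from const[OF this, of c] show ?thesis
    unfolding converges_in_def quasi_subnet_def using dir j0 const_tail by fastforce
qed

lemma inj_finite_nat_sets_infinite_type:
  obtains h :: "nat set \<Rightarrow> 'i::infinite" where "inj_on h {F. finite F}"
proof -
  obtain e :: "nat \<Rightarrow> 'i" where e: "inj e"
    using arb_countable_map[of "{}"] by auto
  have "inj_on (to_nat_on {F::nat set. finite F}) {F. finite F}"
    by (intro inj_on_to_nat_on) (rule countable_Collect_finite)
  then have "inj_on (e \<circ> to_nat_on {F. finite F}) {F :: nat set. finite F}"
    using e by (meson comp_inj_on inj_on_subset subset_UNIV)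
  then show ?thesis
    by (rule that)
qed

lemma unconditional_sum_unique:
  fixes \<eta> :: "('i::infinite, 'v::real_vector) net_convergence" and x :: "nat \<Rightarrow> 'v"
  assumes "hausdorff_vector_convergence \<eta>"
    and s: "unconditional_sum \<eta> x UNIV s" and t: "unconditional_sum \<eta> x UNIV t"
  shows "s = t"
proof -
  interpret hausdorff_vector_convergence \<eta> by fact
  obtain h :: "nat set \<Rightarrow> 'i" where h: "inj_on h {F. finite F}"
    by (rule inj_finite_nat_sets_infinite_type)
  have "converges_in \<eta> {F. finite F} (\<subseteq>) (sum x) s" "converges_in \<eta> {F. finite F} (\<subseteq>) (sum x) t"
    using s t by (simp_all add: unconditional_sum_def)
  from this[THEN converges_in_pullback, OF h] show ?thesis
    by (rule hausdorff)
qed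

text \<open>
  The partial sums are the multiples \<open>n m\<close>. Doubling gives a net with limit \<open>2 m\<close>; but it
  takes values among later partial sums of the same family, so it is a quasi-subnet and has limit \<open>m\<close>
  as well. For \<open>m = \<mu> {}\<close> this says that a \<open>\<sigma>\<close>-additive \<open>\<mu>\<close> vanishes on the empty set.
\<close>

lemma unconditional_sum_const_eq_zero:
  fixes \<eta> :: "('i::infinite, 'v::real_vector) net_convergence"
  assumes "hausdorff_vector_convergence \<eta>"
    and sum: "unconditional_sum \<eta> (\<lambda>_::nat. m) UNIV m"
  shows "m = 0"
proof -
  interpret hausdorff_vector_convergence \<eta> by fact
  obtain h :: "nat set \<Rightarrow> 'i" where h: "inj_on h {F. finite F}"
    by (rule inj_finite_nat_sets_infinite_type)
  define I where "I = h ` {F. finite F}"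
  define r where "r = inv_into {F. finite F} h"
  define x where "x a = sum (\<lambda>_. m) (r a)" for a
  define le where "le a b \<longleftrightarrow> r a \<subseteq> r b" for a b
  have r: "r (h F) = F" if "finite F" for F
    using that h by (simp add: r_def)
  have x: "\<eta> I le x m"
    using converges_in_pullback[OF _ h, of "(\<subseteq>)" "sum (\<lambda>_. m)" m] sum
    unfolding unconditional_sum_def I_def r_def le_def x_def by simp
  have "quasi_subnet I le (\<lambda>a. 2 *\<^sub>R x a) I le x"
    unfolding quasi_subnet_def
  proof (intro ballI bexI image_subsetI)
    fix a0 a assume "a \<in> {a \<in> I. le a0 a}"
    then obtain F where F: "finite F" "a = h F" "r a0 \<subseteq> F"
      by (auto simp: I_def le_def r)
    \<comment> \<open>Adjoining as many new indices as \<open>F\<close> has doubles the sum over \<open>F\<close>.\<close>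
    obtain E where E: "E \<subseteq> - F" "finite E" "card E = card F"
      using infinite_arbitrarily_large[of "- F" "card F"] F(1) by auto
    have "card (F \<union> E) = 2 * card F"
      using E F(1) by (subst card_Un_disjoint) auto
    then have "2 *\<^sub>R x a = x (h (F \<union> E))"
      using F(1,2) E(2) by (simp add: x_def r sum_constant_scaleR)
    moreover have "h (F \<union> E) \<in> {a \<in> I. le a0 a}"
      using F E(2) by (auto simp: I_def le_def r)
    ultimately show "2 *\<^sub>R x a \<in> x ` {a \<in> I. le a0 a}"
      by blast
  qed
  then have "\<eta> I le (\<lambda>a. 2 *\<^sub>R x a) m"
    using subnet[OF x net[OF x]] by blast
  then have "m = 2 *\<^sub>R m"
    using hausdorff scale[OF x] by blast
  then show ?thesis
    by (simp add: scaleR_2)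
qed

text \<open>
  A finite disjoint family is padded with empty sets, which have value \<open>0\<close>; the partial sums are then
  eventually equal to the finite sum, so this is the unconditional sum.
\<close>

lemma sigma_additive_imp_additive:
  fixes \<eta> :: "('i::infinite, 'y::riesz_space) net_convergence"
  assumes conv: "hausdorff_vector_convergence \<eta>" and H: "sigma_algebra \<Omega> H"
    and \<mu>: "sigma_additive \<eta> H \<mu>"
    and C: "finite C" "C \<subseteq> H" "disjoint C"
  shows "\<mu> (\<Union>C) = sum \<mu> C"
proof -
  interpret hausdorff_vector_convergence \<eta> by fact
  interpret sigma_algebra \<Omega> H by fact
  have "unconditional_sum \<eta> (\<lambda>_::nat. \<mu> {}) UNIV (\<mu> {})"
    using \<mu>[unfolded sigma_additive_def, rule_format, of "\<lambda>_. {}"]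
    by (simp add: disjoint_family_on_def)
  then have empty: "\<mu> {} = 0"
    using unconditional_sum_const_eq_zero[OF conv] by blast
  obtain b where b: "bij_betw b {..<card C} C"
    using ex_bij_betw_nat_finite[OF C(1)] by (auto simp: atLeast0LessThan)
  define A where "A n = (if n < card C then b n else {})" for n
  have bC: "b n \<in> C" if "n < card C" for n
    using b that by (auto simp: bij_betw_def)
  have "range A \<subseteq> H"
    using bC C(2) by (auto simp: A_def)
  moreover have "disjoint_family A"
    unfolding disjoint_family_on_def
  proof (intro ballI impI)
    fix m n :: nat assume mn: "m \<noteq> n"
    have "b m \<inter> b n = {}" if "m < card C" "n < card C"
    proof -
      have "b m \<noteq> b n"
        using b mn that by (auto simp: bij_betw_def inj_on_def)
      then show ?thesis
        using C(3) bC that by (simp add: disjoint_def)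
    qed
    then show "A m \<inter> A n = {}"
      by (simp add: A_def)
  qed
  moreover have UA: "(\<Union>n. A n) = \<Union>C"
    using b by (auto simp: A_def bij_betw_def split: if_splits)
  moreover have "\<Union>C \<in> H"
    using C by (intro finite_Union) auto
  ultimately have "unconditional_sum \<eta> (\<lambda>n. \<mu> (A n)) UNIV (\<mu> (\<Union>C))"
    using \<mu>[unfolded sigma_additive_def, rule_format, of A] by (simp only: UA)
  moreover have "unconditional_sum \<eta> (\<lambda>n. \<mu> (A n)) UNIV (sum \<mu> C)"
    unfolding unconditional_sum_def
  proof (rule converges_in_eventually_const[OF directed_set_finite_subsets])
    show "{..<card C} \<in> {F. finite F \<and> F \<subseteq> UNIV}"
      by simp
    fix F :: "nat set" assume F: "F \<in> {F. finite F \<and> F \<subseteq> UNIV}" "{..<card C} \<subseteq> F"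
    have "(\<Sum>n\<in>F. \<mu> (A n)) = (\<Sum>n<card C. \<mu> (A n))"
      using F by (intro sum.mono_neutral_right) (auto simp: A_def empty)
    also have "\<dots> = (\<Sum>n<card C. \<mu> (b n))"
      by (intro sum.cong) (auto simp: A_def)
    also have "\<dots> = sum \<mu> C"
      by (rule sum.reindex_bij_betw[OF b])
    finally show "(\<Sum>n\<in>F. \<mu> (A n)) = sum \<mu> C" .
  qed
  ultimately show ?thesis
    by (rule unconditional_sum_unique[OF conv])
qed

section \<open>(D)-sequences\<close>

lemma D_sequence_bdd_above:
  fixes a :: "nat \<Rightarrow> nat \<Rightarrow> 'z::riesz_space"
  assumes "D_sequence a"
  shows "bdd_above (range (\<lambda>i. a i (\<phi> i)))"
proof -
  obtain M where "\<bar>a i j\<bar> \<le> M" for i j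
    using assms unfolding D_sequence_def by blast
  then have "a i (\<phi> i) \<le> M" for i
    using abs_le_D1 by blast
  then show ?thesis
    by (intro bdd_aboveI[of _ M]) auto
qed

text \<open>
  Replacing \<open>\<phi>\<close> and \<open>\<psi>\<close> by their pointwise maximum shrinks both suprema, so the two error terms may be
  taken at independent functions. Weak \<open>\<sigma>\<close>-distributivity then removes one after the other.
\<close>

lemma weakly_sigma_distributive_absorb:
  fixes a b :: "nat \<Rightarrow> nat \<Rightarrow> 'z::{riesz_space, conditionally_complete_lattice}"
  assumes wsd: "weakly_sigma_distributive TYPE('z)"
    and a: "D_sequence a" and b: "D_sequence b"
    and le: "\<And>\<phi>. x \<le> c + (SUP i. a i (\<phi> i)) + (SUP i. b i (\<phi> i))"
  shows "x \<le> c"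
proof -
  have glb: "isGlb UNIV (range (\<lambda>\<phi>. SUP i. d i (\<phi> i))) 0"
    if "D_sequence d" for d :: "nat \<Rightarrow> nat \<Rightarrow> 'z"
    using wsd that by (auto simp: weakly_sigma_distributive_def)
  have anti: "(SUP i. d i (\<psi> i)) \<le> (SUP i. d i (\<phi> i))"
    if d: "D_sequence d" and "\<And>i. \<phi> i \<le> \<psi> i" for d :: "nat \<Rightarrow> nat \<Rightarrow> 'z" and \<phi> \<psi>
  proof (rule cSUP_mono)
    fix i
    have "decseq (d i)"
      using d by (simp add: D_sequence_def)
    then show "\<exists>j\<in>UNIV. d i (\<psi> i) \<le> d j (\<phi> j)"
      using that(2) by (auto simp: decseq_def)
  qed (use D_sequence_bdd_above[OF d] in auto)
  have "x \<le> (c + (SUP i. a i (\<phi> i))) + (SUP i. b i (\<psi> i))" for \<phi> \<psi>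
  proof -
    let ?\<chi> = "\<lambda>i. max (\<phi> i) (\<psi> i)"
    have "x \<le> c + (SUP i. a i (?\<chi> i)) + (SUP i. b i (?\<chi> i))"
      by (rule le)
    also have "\<dots> \<le> c + (SUP i. a i (\<phi> i)) + (SUP i. b i (\<psi> i))"
      by (intro add_mono order_refl anti a b) auto
    finally show ?thesis .
  qed
  then have "x \<le> c + (SUP i. a i (\<phi> i)) + s" if "s \<in> range (\<lambda>\<psi>. SUP i. b i (\<psi> i))" for \<phi> s
    using that by blast
  from isGlb_zero_absorb[OF glb[OF b] this] have "x \<le> c + (SUP i. a i (\<phi> i))" for \<phi> .
  then have "x \<le> c + s" if "s \<in> range (\<lambda>\<phi>. SUP i. a i (\<phi> i))" for s
    using that by blast
  from isGlb_zero_absorb[OF glb[OF a] this] show ?thesis .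
qed

lemma isGlb_scaleR_two:
  fixes x :: "'k \<Rightarrow> 'a::ordered_real_vector"
  assumes "isGlb UNIV (range x) 0"
  shows "isGlb UNIV (range (\<lambda>k. 2 *\<^sub>R x k)) 0"
proof -
  have "t \<le> 0" if t: "\<And>k. t \<le> 2 *\<^sub>R x k" for t
  proof -
    have "\<forall>k. (1/2) *\<^sub>R t \<le> x k"
    proof
      fix k show "(1/2) *\<^sub>R t \<le> x k"
        using scaleR_left_mono[OF t, of "1/2" k] by simp
    qed
    then have "(1/2) *\<^sub>R t \<le> 0"
      using assms by (auto simp: isGlb_UNIV_iff)
    from scaleR_left_mono[OF this, of 2] show ?thesis
      by simp
  qed
  then show ?thesis
    using assms by (auto simp: isGlb_UNIV_iff scaleR_nonneg_nonneg)
qed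

lemma isGlb_zero_dominated:
  fixes x y :: "'k \<Rightarrow> 'a::ordered_ab_group_add"
  assumes "isGlb UNIV (range x) 0" "\<And>k. 0 \<le> y k" "\<And>k. y k \<le> x k"
  shows "isGlb UNIV (range y) 0"
proof -
  have "t \<le> 0" if "\<And>k. t \<le> y k" for t
  proof -
    have "t \<le> x k" for k
      using that[of k] assms(3)[of k] by (rule order_trans)
    then show ?thesis
      using assms(1) by (simp add: isGlb_UNIV_iff)
  qed
  then show ?thesis
    using assms(2) by (simp add: isGlb_UNIV_iff)
qed

text \<open>
  Countably many (D)-sequences and a sequence decreasing to \<open>0\<close> are dominated by one (D)-sequence, as
  far as elements below a fixed \<open>w\<close> are concerned. The rows of \<open>b\<close> are \<open>v\<close> and all rows of all \<open>a n\<close>;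
  the first value \<open>\<phi> 0\<close> selects \<open>n\<close>, and the remaining values of \<open>\<phi>\<close> contain a function \<open>\<psi>\<close> for \<open>a n\<close>. The rows
  are cut off at \<open>w\<close>, for there is no common bound for all \<open>a n\<close>, and infinite distributivity
  shows that elements below \<open>w\<close> do not notice. The factor \<open>2\<close> pays for replacing a sum of two
  terms by a supremum.
\<close>

lemma D_sequence_merge:
  fixes a :: "nat \<Rightarrow> nat \<Rightarrow> nat \<Rightarrow> 'z::{riesz_space, conditionally_complete_lattice}"
  assumes a: "\<And>n. D_sequence (a n)"
    and v: "decseq v" "isGlb UNIV (range v) 0" and w: "0 \<le> w"
  shows "\<exists>b. D_sequence b \<and> (\<forall>\<phi>. \<exists>n \<psi>. \<forall>x.
    x \<le> w \<longrightarrow> x \<le> v n + (SUP k. a n k (\<psi> k)) \<longrightarrow> x \<le> (SUP i. b i (\<phi> i)))"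
proof -
  define b where "b i j = (case i of 0 \<Rightarrow> 2 *\<^sub>R v j
    | Suc m \<Rightarrow> 2 *\<^sub>R inf w (a (fst (prod_decode m)) (snd (prod_decode m)) j))" for i j
  have v0: "0 \<le> v j" for j
    using v(2) by (auto simp: isGlb_UNIV_iff)
  have a0: "0 \<le> a n k j" for n k j
    using a[of n] by (auto simp: D_sequence_def isGlb_UNIV_iff)
  have a_dec: "decseq (a n k)" for n k
    using a[of n] by (simp add: D_sequence_def)
  have "decseq (b i)" for i
    unfolding decseq_def
  proof (intro allI impI)
    fix m n :: nat assume "m \<le> n"
    then show "b i n \<le> b i m"
      using v(1) a_dec
      by (auto simp: b_def decseq_def le_infI2 intro!: scaleR_left_mono inf_mono split: nat.split)
  qed
  moreover have "isGlb UNIV (range (b i)) 0" for i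
  proof (cases i)
    case 0
    then show ?thesis
      using isGlb_scaleR_two[OF v(2)] by (simp add: b_def)
  next
    case (Suc m)
    define n k where "n = fst (prod_decode m)" and "k = snd (prod_decode m)"
    have "isGlb UNIV (range (a n k)) 0"
      using a[of n] by (simp add: D_sequence_def)
    then have "isGlb UNIV (range (\<lambda>j. inf w (a n k j))) 0"
      by (rule isGlb_zero_dominated) (use w a0 in auto)
    then have "isGlb UNIV (range (\<lambda>j. 2 *\<^sub>R inf w (a n k j))) 0"
      by (rule isGlb_scaleR_two)
    then show ?thesis
      using Suc by (simp add: b_def n_def k_def)
  qed
  moreover have "\<bar>b i j\<bar> \<le> 2 *\<^sub>R (w + v 0)" for i j
  proof -
    have "v j \<le> w + v 0"
      using v(1) w by (auto simp: decseq_def intro: add_increasing)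
    moreover have "inf w y \<le> w + v 0" for y
      using v0[of 0] by (intro le_infI1) simp
    ultimately have "b i j \<le> 2 *\<^sub>R (w + v 0)"
      by (auto simp: b_def intro!: scaleR_left_mono split: nat.split)
    moreover have "0 \<le> b i j"
      using v0 a0 w by (auto simp: b_def intro!: scaleR_nonneg_nonneg split: nat.split)
    ultimately show ?thesis
      by simp
  qed
  ultimately have D: "D_sequence b"
    unfolding D_sequence_def by blast
  have "\<exists>n \<psi>. \<forall>x. x \<le> w \<longrightarrow> x \<le> v n + (SUP k. a n k (\<psi> k)) \<longrightarrow> x \<le> (SUP i. b i (\<phi> i))" for \<phi>
  proof (intro exI allI impI)
    define n where "n = \<phi> 0"
    define \<psi> where "\<psi> k = \<phi> (Suc (prod_encode (n, k)))" for k
    let ?B = "SUP i. b i (\<phi> i)"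
    fix x assume xw: "x \<le> w" and x: "x \<le> v n + (SUP k. a n k (\<psi> k))"
    have B: "b i (\<phi> i) \<le> ?B" for i
      using D_sequence_bdd_above[OF D] by (intro cSUP_upper) auto
    have half: "y \<le> (1/2) *\<^sub>R ?B" if "2 *\<^sub>R y \<le> ?B" for y
      using scaleR_left_mono[OF that, of "1/2"] by simp
    have "v n \<le> (1/2) *\<^sub>R ?B"
      using B[of 0] by (intro half) (simp add: b_def n_def)
    moreover have "inf w (a n k (\<psi> k)) \<le> (1/2) *\<^sub>R ?B" for k
      using B[of "Suc (prod_encode (n, k))"] by (intro half) (simp add: b_def \<psi>_def)
    then have "(SUP k. inf w (a n k (\<psi> k))) \<le> (1/2) *\<^sub>R ?B"
      by (intro cSUP_least) auto
    moreover have "x - v n \<le> inf w (SUP k. a n k (\<psi> k))"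
    proof (rule inf_greatest)
      show "x - v n \<le> w"
        using xw v0[of n] add_mono[of x w 0 "v n"] by (simp add: diff_le_eq)
      show "x - v n \<le> (SUP k. a n k (\<psi> k))"
        using x by (simp add: diff_le_eq add.commute)
    qed
    then have "x - v n \<le> (SUP k. inf w (a n k (\<psi> k)))"
      using inf_le_SUP_inf[OF D_sequence_bdd_above[OF a]] order_trans by blast
    ultimately have "(x - v n) + v n \<le> (1/2) *\<^sub>R ?B + (1/2) *\<^sub>R ?B"
      by (meson add_mono order_trans)
    then show "x \<le> ?B"
      by (simp flip: scaleR_add_left)
  qed
  with D show ?thesis
    by (intro exI[of _ b] conjI allI)
qed

section \<open>Sufficiently fine partitions\<close>

text \<open>
  Under this filter, a property holds eventually if it holds for all partitions beyond some partition;
  finitely many such conditions can then be combined without naming common refinements.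
\<close>

definition refinements :: "'w set set \<Rightarrow> 'w set \<Rightarrow> 'w set set filter" where
  "refinements H A =
     (INF P0\<in>countable_partitions H A. principal {P \<in> countable_partitions H A. refined_by P0 P})"

lemma refined_by_refl: "refined_by P P"
  by (auto simp: refined_by_def)

lemma refined_by_trans: "refined_by P Q \<Longrightarrow> refined_by Q R \<Longrightarrow> refined_by P R"
  unfolding refined_by_def by (meson order_trans)

lemma (in sigma_algebra) countable_partitions_directed:
  assumes P: "P \<in> countable_partitions M \<Omega>" and Q: "Q \<in> countable_partitions M \<Omega>"
  obtains R where "R \<in> countable_partitions M \<Omega>" "refined_by P R" "refined_by Q R"
proof -
  define R where "R = common_refinement {P, Q}"
  have part: "partition_on \<Omega> S" if "S \<in> {P, Q}" for S
    using that P Q by (auto simp: countable_partitions_def)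
  have "partition_on \<Omega> R"
    unfolding R_def by (rule partition_on_common_refinement[OF part]) auto
  moreover have "R \<subseteq> (\<lambda>(\<alpha>, \<beta>). \<alpha> \<inter> \<beta>) ` (P \<times> Q)"
    by (auto simp: R_def common_refinement)
  moreover have "(\<lambda>(\<alpha>, \<beta>). \<alpha> \<inter> \<beta>) ` (P \<times> Q) \<subseteq> M"
    using P Q by (auto simp: countable_partitions_def)
  moreover have "countable ((\<lambda>(\<alpha>, \<beta>). \<alpha> \<inter> \<beta>) ` (P \<times> Q))"
    using P Q by (simp add: countable_partitions_def)
  ultimately have "partition_on \<Omega> R" "R \<subseteq> M" "countable R"
    by (auto intro: countable_subset)
  then have "R \<in> countable_partitions M \<Omega>"
    by (simp add: countable_partitions_def)
  moreover have "refined_by P R" "refined_by Q R"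
    using common_refinement_exists[of _ "{P, Q}"] by (auto simp: refined_by_def R_def)
  ultimately show ?thesis
    by (rule that)
qed

lemma (in sigma_algebra) two_set_partition:
  assumes "A \<in> M"
  shows "{A, \<Omega> - A} - {{}} \<in> countable_partitions M \<Omega>"
  using assms sets_into_space[OF assms]
  by (auto simp: countable_partitions_def partition_on_def disjoint_def)

lemma (in sigma_algebra) eventually_refinements:
  "eventually \<Phi> (refinements M \<Omega>) \<longleftrightarrow>
     (\<exists>P0\<in>countable_partitions M \<Omega>. \<forall>P\<in>countable_partitions M \<Omega>. refined_by P0 P \<longrightarrow> \<Phi> P)"
  unfolding refinements_def
proof (subst eventually_INF_base)
  show "countable_partitions M \<Omega> \<noteq> {}"
    using two_set_partition[OF empty_sets] by blast
  fix P Q assume "P \<in> countable_partitions M \<Omega>" "Q \<in> countable_partitions M \<Omega>"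
  then obtain R where "R \<in> countable_partitions M \<Omega>" "refined_by P R" "refined_by Q R"
    by (rule countable_partitions_directed)
  then show "\<exists>R\<in>countable_partitions M \<Omega>.
      principal {S \<in> countable_partitions M \<Omega>. refined_by R S}
      \<le> inf (principal {S \<in> countable_partitions M \<Omega>. refined_by P S})
            (principal {S \<in> countable_partitions M \<Omega>. refined_by Q S})"
    by (intro bexI[of _ R]) (auto intro: refined_by_trans)
qed (auto simp: eventually_principal)

lemma (in sigma_algebra) eventually_refinements_partition:
  "eventually (\<lambda>P. P \<in> countable_partitions M \<Omega>) (refinements M \<Omega>)"
  using two_set_partition[OF empty_sets] unfolding eventually_refinements by blast

lemma (in sigma_algebra) refinements_neq_bot: "refinements M \<Omega> \<noteq> bot"
  unfolding trivial_limit_def eventually_refinements using refined_by_refl by blast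

lemma (in sigma_algebra) eventually_refinements_split:
  assumes "A \<in> M"
  shows "eventually (\<lambda>P. \<forall>\<alpha>\<in>P. \<alpha> \<subseteq> A \<or> \<alpha> \<subseteq> \<Omega> - A) (refinements M \<Omega>)"
  unfolding eventually_refinements
  by (rule bexI[OF _ two_set_partition[OF assms]]) (auto simp: refined_by_def)

definition Riemann_sums_within ::
  "('x \<Rightarrow> 'y \<Rightarrow> 'z::riesz_space) \<Rightarrow> 'w set \<Rightarrow> ('w set \<Rightarrow> 'y) \<Rightarrow> ('w \<Rightarrow> 'x) \<Rightarrow> 'z \<Rightarrow> 'z \<Rightarrow> 'w set set \<Rightarrow> bool"
where
  "Riemann_sums_within bprod \<Omega> \<mu> f z e P \<longleftrightarrow> (\<forall>\<delta>. choice_function \<Omega> \<delta> \<longrightarrow>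
     (\<exists>s. has_order_sum (\<lambda>\<alpha>. bprod (f (\<delta> \<alpha>)) (\<mu> \<alpha>)) P s \<and> \<bar>s - z\<bar> \<le> e))"

lemma Riemann_sums_within_iff:
  "Riemann_sums_within bprod \<Omega> \<mu> f z e P \<longleftrightarrow>
     (\<forall>\<delta>. choice_function \<Omega> \<delta> \<longrightarrow> (\<exists>s. has_order_sum (\<lambda>\<alpha>. bprod (f (\<delta> \<alpha>)) (\<mu> \<alpha>)) P s)) \<and>
     (\<forall>\<delta>. choice_function \<Omega> \<delta> \<longrightarrow>
        \<bar>order_sum (\<lambda>\<alpha>. bprod (f (\<delta> \<alpha>)) (\<mu> \<alpha>)) P - z\<bar> \<le> e)"
proof -
  have "(\<exists>s. has_order_sum h P s \<and> \<bar>s - z\<bar> \<le> e) \<longleftrightarrow>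
      (\<exists>s. has_order_sum h P s) \<and> \<bar>order_sum h P - z\<bar> \<le> e" for h
    using order_sum_eq[of h P] by blast
  then show ?thesis
    unfolding Riemann_sums_within_def by blast
qed

text \<open>
  The definition of the integral asks for sums beyond a partition that does not depend on \<open>\<phi>\<close>. For the
  converse direction, passing to a common refinement with that partition puts each \<open>P0\<close> beyond it.
\<close>

lemma (in sigma_algebra) has_Sstar_integral_iff:
  fixes bprod :: "'x \<Rightarrow> 'y \<Rightarrow> 'z::{riesz_space, conditionally_complete_lattice}"
  shows "has_Sstar_integral bprod \<Omega> M \<mu> \<Omega> f z \<longleftrightarrow>
     (\<exists>a. D_sequence a \<and> (\<forall>\<phi>. eventually
        (Riemann_sums_within bprod \<Omega> \<mu> f z (SUP i. a i (\<phi> i))) (refinements M \<Omega>)))"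
proof -
  define summable where "summable P \<longleftrightarrow> (\<forall>\<delta>. choice_function \<Omega> \<delta> \<longrightarrow>
    (\<exists>s. has_order_sum (\<lambda>\<alpha>. bprod (f (\<delta> \<alpha>)) (\<mu> \<alpha>)) P s))" for P
  define close where "close e P \<longleftrightarrow> (\<forall>\<delta>. choice_function \<Omega> \<delta> \<longrightarrow>
    \<bar>order_sum (\<lambda>\<alpha>. bprod (f (\<delta> \<alpha>)) (\<mu> \<alpha>)) P - z\<bar> \<le> e)" for e P
  let ?\<Pi> = "countable_partitions M \<Omega>"
  have within: "Riemann_sums_within bprod \<Omega> \<mu> f z e P \<longleftrightarrow> summable P \<and> close e P" for e P
    unfolding Riemann_sums_within_iff summable_def close_def by (rule refl)
  have "has_Sstar_integral bprod \<Omega> M \<mu> \<Omega> f z \<longleftrightarrow>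
      (\<exists>Ps\<in>?\<Pi>. (\<forall>P\<in>?\<Pi>. refined_by Ps P \<longrightarrow> summable P) \<and> (\<exists>a. D_sequence a \<and>
        (\<forall>\<phi>. \<exists>P0\<in>?\<Pi>. refined_by Ps P0 \<and>
          (\<forall>P\<in>?\<Pi>. refined_by P0 P \<longrightarrow> close (SUP i. a i (\<phi> i)) P))))"
    unfolding has_Sstar_integral_def summable_def close_def by (rule refl)
  also have "\<dots> \<longleftrightarrow> (\<exists>a. D_sequence a \<and> eventually summable (refinements M \<Omega>) \<and>
      (\<forall>\<phi>. eventually (close (SUP i. a i (\<phi> i))) (refinements M \<Omega>)))" (is "?L \<longleftrightarrow> ?R")
  proof
    assume ?L
    then show ?R
      unfolding eventually_refinements by blast
  next
    assume ?R
    then obtain a Ps where a: "D_sequence a"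
      and Ps: "Ps \<in> ?\<Pi>" "\<forall>P\<in>?\<Pi>. refined_by Ps P \<longrightarrow> summable P"
      and close: "\<forall>\<phi>. \<exists>P0\<in>?\<Pi>. \<forall>P\<in>?\<Pi>. refined_by P0 P \<longrightarrow> close (SUP i. a i (\<phi> i)) P"
      unfolding eventually_refinements by blast
    have "\<exists>P0\<in>?\<Pi>. refined_by Ps P0 \<and>
        (\<forall>P\<in>?\<Pi>. refined_by P0 P \<longrightarrow> close (SUP i. a i (\<phi> i)) P)" for \<phi>
    proof -
      obtain P1 where P1: "P1 \<in> ?\<Pi>" "\<forall>P\<in>?\<Pi>. refined_by P1 P \<longrightarrow> close (SUP i. a i (\<phi> i)) P"
        using close by blast
      obtain P0 where "P0 \<in> ?\<Pi>" "refined_by Ps P0" "refined_by P1 P0"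
        by (rule countable_partitions_directed[OF Ps(1) P1(1)])
      then show ?thesis
        using P1(2) refined_by_trans by blast
    qed
    with a Ps show ?L
      by blast
  qed
  also have "\<dots> \<longleftrightarrow> (\<exists>a. D_sequence a \<and>
      (\<forall>\<phi>. eventually (Riemann_sums_within bprod \<Omega> \<mu> f z (SUP i. a i (\<phi> i))) (refinements M \<Omega>)))"
    unfolding within[abs_def] eventually_conj_iff by blast
  finally show ?thesis .
qed

section \<open>Integration against a positive additive set function\<close>

text \<open>
  The properties of a measure and of a product on which the estimates for Riemann sums rest:
  terms are nonnegative, and finite sums of \<open>\<mu> \<alpha>\<close> over a countable partition are bounded by \<open>\<mu> \<Omega>\<close>.
\<close>

locale positive_additive_measure = sigma_algebra \<Omega> M
  for \<Omega> :: "'w set" and M :: "'w set set" +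
  fixes bprod :: "'x::riesz_space \<Rightarrow> 'y::riesz_space \<Rightarrow> 'z::{riesz_space, conditionally_complete_lattice}"
    and \<mu> :: "'w set \<Rightarrow> 'y"
  assumes bilinear: "bilinear bprod"
    and bprod_nonneg: "0 \<le> a \<Longrightarrow> 0 \<le> b \<Longrightarrow> 0 \<le> bprod a b"
    and measure_nonneg: "A \<in> M \<Longrightarrow> 0 \<le> \<mu> A"
    and additive: "finite C \<Longrightarrow> C \<subseteq> M \<Longrightarrow> disjoint C \<Longrightarrow> \<mu> (\<Union>C) = sum \<mu> C"
begin

lemma measure_mono:
  assumes "A \<in> M" "B \<in> M" "A \<subseteq> B"
  shows "\<mu> A \<le> \<mu> B"
proof (cases "A = {}")
  case True
  then show ?thesis
    using additive[of "{}"] measure_nonneg[OF assms(2)] by simp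
next
  case False
  then have "A \<noteq> B - A"
    by blast
  moreover have "\<mu> (\<Union>{A, B - A}) = sum \<mu> {A, B - A}"
    using assms by (intro additive) (auto simp: disjoint_def)
  moreover have "\<Union>{A, B - A} = B"
    using assms(3) by blast
  ultimately have "\<mu> B = \<mu> A + \<mu> (B - A)"
    by simp
  then show ?thesis
    using measure_nonneg[OF Diff[OF assms(2,1)]] by simp
qed

lemma sum_measure_partition_le:
  assumes P: "P \<in> countable_partitions M \<Omega>" and F: "finite F" "F \<subseteq> P"
  shows "sum \<mu> F \<le> \<mu> \<Omega>"
proof -
  have FM: "F \<subseteq> M"
    using F P by (auto simp: countable_partitions_def)
  have "disjoint F"
    using F P by (auto simp: countable_partitions_def partition_on_def intro: pairwise_subset)
  then have "sum \<mu> F = \<mu> (\<Union>F)"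
    using additive F(1) FM by simp
  also have "\<dots> \<le> \<mu> \<Omega>"
    using FM F(1) sets_into_space by (intro measure_mono finite_Union) auto
  finally show ?thesis .
qed

lemma bprod_left_mono:
  assumes "a \<le> a'" "0 \<le> b"
  shows "bprod a b \<le> bprod a' b"
  using bprod_nonneg[of "a' - a" b] assms by (simp add: bilinear_lsub[OF bilinear])

lemma bprod_right_mono:
  assumes "0 \<le> a" "b \<le> b'"
  shows "bprod a b \<le> bprod a b'"
  using bprod_nonneg[of a "b' - b"] assms by (simp add: bilinear_rsub[OF bilinear])

text \<open>
  The basic estimate. Each term changes by at most \<open>c \<mu>(\<alpha>)\<close>: pieces inside \<open>N\<close> have measure \<open>0\<close>, and
  tags of the others lie where \<open>g\<close> and \<open>h\<close> differ by at most \<open>c\<close>. The errors add up to at most \<open>c \<mu>(\<Omega>)\<close>.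
  The partition has to be split along \<open>N\<close> because a tag in \<open>N\<close> says nothing about a piece that sticks out
  of it.
\<close>

lemma Riemann_sum_close:
  assumes P: "P \<in> countable_partitions M \<Omega>" and split: "\<forall>\<alpha>\<in>P. \<alpha> \<subseteq> N \<or> \<alpha> \<subseteq> \<Omega> - N"
    and N: "N \<in> M" "\<mu> N = 0" and \<delta>: "choice_function \<Omega> \<delta>"
    and g: "\<And>\<omega>. \<omega> \<in> \<Omega> \<Longrightarrow> 0 \<le> g \<omega>" and h: "\<And>\<omega>. \<omega> \<in> \<Omega> \<Longrightarrow> 0 \<le> h \<omega>"
    and c: "0 \<le> c" and close: "\<And>\<omega>. \<omega> \<in> \<Omega> - N \<Longrightarrow> \<bar>g \<omega> - h \<omega>\<bar> \<le> c"
    and s: "has_order_sum (\<lambda>\<alpha>. bprod (h (\<delta> \<alpha>)) (\<mu> \<alpha>)) P s"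
  shows "\<exists>t. has_order_sum (\<lambda>\<alpha>. bprod (g (\<delta> \<alpha>)) (\<mu> \<alpha>)) P t \<and> \<bar>t - s\<bar> \<le> bprod c (\<mu> \<Omega>)"
proof (rule has_order_sum_comparison[OF s])
  fix F assume F: "finite F" "F \<subseteq> P"
  have "(\<Sum>\<alpha>\<in>F. bprod c (\<mu> \<alpha>)) = bprod c (sum \<mu> F)"
    using bilinear linear_sum[of "bprod c" \<mu> F] by (simp add: bilinear_def)
  also have "\<dots> \<le> bprod c (\<mu> \<Omega>)"
    by (rule bprod_right_mono[OF c sum_measure_partition_le[OF P F]])
  finally show "(\<Sum>\<alpha>\<in>F. bprod c (\<mu> \<alpha>)) \<le> bprod c (\<mu> \<Omega>)" .
next
  fix \<alpha> assume \<alpha>: "\<alpha> \<in> P"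
  have \<alpha>M: "\<alpha> \<in> M" and "\<alpha> \<noteq> {}" "\<alpha> \<subseteq> \<Omega>"
    using \<alpha> P by (auto simp: countable_partitions_def partition_on_def)
  then have in\<alpha>: "\<delta> \<alpha> \<in> \<alpha>" and in\<Omega>: "\<delta> \<alpha> \<in> \<Omega>"
    using \<delta> by (auto simp: choice_function_def)
  note \<mu>\<alpha> = measure_nonneg[OF \<alpha>M]
  show "0 \<le> bprod (g (\<delta> \<alpha>)) (\<mu> \<alpha>)" "0 \<le> bprod (h (\<delta> \<alpha>)) (\<mu> \<alpha>)"
    using bprod_nonneg g[OF in\<Omega>] h[OF in\<Omega>] \<mu>\<alpha> by auto
  have cases: "\<mu> \<alpha> = 0 \<or> \<bar>g (\<delta> \<alpha>) - h (\<delta> \<alpha>)\<bar> \<le> c"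
  proof (cases "\<alpha> \<subseteq> N")
    case True
    then have "\<mu> \<alpha> \<le> 0"
      using measure_mono[OF \<alpha>M N(1)] N(2) by simp
    then show ?thesis
      using \<mu>\<alpha> by simp
  next
    case False
    then show ?thesis
      using split \<alpha> in\<alpha> close by blast
  qed
  have le: "bprod p (\<mu> \<alpha>) \<le> bprod q (\<mu> \<alpha>) + bprod c (\<mu> \<alpha>)"
    if "\<mu> \<alpha> = 0 \<or> p - q \<le> c" for p q
    using that
  proof
    assume "\<mu> \<alpha> = 0"
    then show ?thesis
      by (simp add: bilinear_rzero[OF bilinear])
  next
    assume "p - q \<le> c"
    then have "bprod p (\<mu> \<alpha>) \<le> bprod (q + c) (\<mu> \<alpha>)"
      using \<mu>\<alpha> by (intro bprod_left_mono) (simp_all add: diff_le_eq add.commute)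
    then show ?thesis
      by (simp add: bilinear_ladd[OF bilinear])
  qed
  show "bprod (g (\<delta> \<alpha>)) (\<mu> \<alpha>) \<le> bprod (h (\<delta> \<alpha>)) (\<mu> \<alpha>) + bprod c (\<mu> \<alpha>)"
    using cases abs_le_D1 by (intro le) blast
  show "bprod (h (\<delta> \<alpha>)) (\<mu> \<alpha>) \<le> bprod (g (\<delta> \<alpha>)) (\<mu> \<alpha>) + bprod c (\<mu> \<alpha>)"
    using cases abs_le_D2[of "g (\<delta> \<alpha>) - h (\<delta> \<alpha>)" c] by (intro le) auto
qed

text \<open>
  Passes the estimate for Riemann sums to the integrals. The two integrals are approximated with
  different (D)-sequences, which weak \<open>\<sigma>\<close>-distributivity removes. Uniqueness of the integral is the
  case \<open>c = 0\<close>.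
\<close>

lemma integral_difference_le:
  assumes wsd: "weakly_sigma_distributive TYPE('z)"
    and N: "N \<in> M" "\<mu> N = 0"
    and g: "\<And>\<omega>. \<omega> \<in> \<Omega> \<Longrightarrow> 0 \<le> g \<omega>" and h: "\<And>\<omega>. \<omega> \<in> \<Omega> \<Longrightarrow> 0 \<le> h \<omega>"
    and c: "0 \<le> c" and close: "\<And>\<omega>. \<omega> \<in> \<Omega> - N \<Longrightarrow> \<bar>g \<omega> - h \<omega>\<bar> \<le> c"
    and y: "has_Sstar_integral bprod \<Omega> M \<mu> \<Omega> g y" and z: "has_Sstar_integral bprod \<Omega> M \<mu> \<Omega> h z"
  shows "\<bar>y - z\<bar> \<le> bprod c (\<mu> \<Omega>)"
proof -
  obtain a where a: "D_sequence a" and ev_g: "\<And>\<phi>. eventually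
      (Riemann_sums_within bprod \<Omega> \<mu> g y (SUP i. a i (\<phi> i))) (refinements M \<Omega>)"
    using y unfolding has_Sstar_integral_iff by blast
  obtain b where b: "D_sequence b" and ev_h: "\<And>\<phi>. eventually
      (Riemann_sums_within bprod \<Omega> \<mu> h z (SUP i. b i (\<phi> i))) (refinements M \<Omega>)"
    using z unfolding has_Sstar_integral_iff by blast
  define \<delta> :: "'w set \<Rightarrow> 'w" where "\<delta> \<alpha> = (SOME \<omega>. \<omega> \<in> \<alpha>)" for \<alpha>
  have \<delta>: "choice_function \<Omega> \<delta>"
    by (simp add: choice_function_def \<delta>_def some_in_eq)
  show ?thesis
  proof (rule weakly_sigma_distributive_absorb[OF wsd a b])
    fix \<phi>
    obtain P where P: "P \<in> countable_partitions M \<Omega>" "\<forall>\<alpha>\<in>P. \<alpha> \<subseteq> N \<or> \<alpha> \<subseteq> \<Omega> - N"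
      "Riemann_sums_within bprod \<Omega> \<mu> g y (SUP i. a i (\<phi> i)) P"
      "Riemann_sums_within bprod \<Omega> \<mu> h z (SUP i. b i (\<phi> i)) P"
      using eventually_happens'[OF refinements_neq_bot
          eventually_conj[OF eventually_refinements_partition
          eventually_conj[OF eventually_refinements_split[OF N(1)]
          eventually_conj[OF ev_g[of \<phi>] ev_h[of \<phi>]]]]] by blast
    obtain s where s: "has_order_sum (\<lambda>\<alpha>. bprod (g (\<delta> \<alpha>)) (\<mu> \<alpha>)) P s"
      "\<bar>s - y\<bar> \<le> (SUP i. a i (\<phi> i))"
      using P(3) \<delta> unfolding Riemann_sums_within_def by blast
    obtain t where t: "has_order_sum (\<lambda>\<alpha>. bprod (h (\<delta> \<alpha>)) (\<mu> \<alpha>)) P t"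
      "\<bar>t - z\<bar> \<le> (SUP i. b i (\<phi> i))"
      using P(4) \<delta> unfolding Riemann_sums_within_def by blast
    obtain s' where s': "has_order_sum (\<lambda>\<alpha>. bprod (g (\<delta> \<alpha>)) (\<mu> \<alpha>)) P s'"
      "\<bar>s' - t\<bar> \<le> bprod c (\<mu> \<Omega>)"
      using Riemann_sum_close[OF P(1,2) N \<delta> g h c close t(1)] by blast
    have "s' = s"
      using order_sum_eq[OF s(1)] order_sum_eq[OF s'(1)] by simp
    have "\<bar>y - z\<bar> = \<bar>(s - t) + (y - s) + (t - z)\<bar>"
      by simp
    also have "\<dots> \<le> \<bar>s - t\<bar> + \<bar>y - s\<bar> + \<bar>t - z\<bar>"
      by (rule order_trans[OF abs_triangle_ineq add_right_mono[OF abs_triangle_ineq]])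
    also have "\<dots> \<le> bprod c (\<mu> \<Omega>) + (SUP i. a i (\<phi> i)) + (SUP i. b i (\<phi> i))"
      using s(2) t(2) s'(2) unfolding \<open>s' = s\<close> abs_minus_commute[of s y]
      by (intro add_mono)
    finally show "\<bar>y - z\<bar> \<le> bprod c (\<mu> \<Omega>) + (SUP i. a i (\<phi> i)) + (SUP i. b i (\<phi> i))" .
  qed
qed

lemma has_Sstar_integral_unique:
  assumes wsd: "weakly_sigma_distributive TYPE('z)" and g: "\<And>\<omega>. \<omega> \<in> \<Omega> \<Longrightarrow> 0 \<le> g \<omega>"
    and y: "has_Sstar_integral bprod \<Omega> M \<mu> \<Omega> g y" and z: "has_Sstar_integral bprod \<Omega> M \<mu> \<Omega> g z"
  shows "y = z"
proof -
  have "\<mu> {} = 0"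
    using additive[of "{}"] by simp
  then have "\<bar>y - z\<bar> \<le> bprod 0 (\<mu> \<Omega>)"
    by (intro integral_difference_le[OF wsd empty_sets _ g g _ _ y z]) auto
  then show ?thesis
    by (simp add: bilinear_lzero[OF bilinear])
qed

text \<open>
  The integrals satisfy \<open>\<bar>I m - I n\<bar> \<le> v m + v n\<close> with \<open>v n = u n \<mu>(\<Omega>)\<close>, so the intervals
  from \<open>I n - v n\<close> to \<open>I n + v n\<close> meet in \<open>z = sup (I n - v n)\<close>. A Riemann sum of the limit function is
  within \<open>v n\<close> of that of \<open>f n\<close>, which is close to \<open>I n\<close>, which is within \<open>v n\<close> of \<open>z\<close>. The closeness to
  \<open>I n\<close> is measured by a (D)-sequence that depends on \<open>n\<close>. The estimate for \<open>n = 0\<close> bounds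
  all Riemann sums of fine partitions by a fixed \<open>w\<close>, and this is what makes merging these countably many
  (D)-sequences into one possible.
\<close>

lemma has_Sstar_integral_uniform_limit:
  assumes wsd: "weakly_sigma_distributive TYPE('z)"
    and N: "N \<in> M" "\<mu> N = 0"
    and f: "\<And>n \<omega>. \<omega> \<in> \<Omega> \<Longrightarrow> 0 \<le> f n \<omega>" and g: "\<And>\<omega>. \<omega> \<in> \<Omega> \<Longrightarrow> 0 \<le> g \<omega>"
    and u0: "\<And>n. 0 \<le> u n" and close: "\<And>n \<omega>. \<omega> \<in> \<Omega> - N \<Longrightarrow> \<bar>f n \<omega> - g \<omega>\<bar> \<le> u n"
    and v: "decseq (\<lambda>n. bprod (u n) (\<mu> \<Omega>))" "isGlb UNIV (range (\<lambda>n. bprod (u n) (\<mu> \<Omega>))) 0"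
    and I: "\<And>n. has_Sstar_integral bprod \<Omega> M \<mu> \<Omega> (f n) (I n)"
  shows "\<exists>z. has_Sstar_integral bprod \<Omega> M \<mu> \<Omega> g z \<and> (\<forall>n. \<bar>I n - z\<bar> \<le> bprod (u n) (\<mu> \<Omega>))"
proof -
  define v where "v n = bprod (u n) (\<mu> \<Omega>)" for n
  have v_dec: "decseq v" and v_glb: "isGlb UNIV (range v) 0"
    using v by (simp_all add: v_def[abs_def])
  have v0: "0 \<le> v n" for n
    using v_glb by (simp add: isGlb_UNIV_iff)
  have I_diff: "\<bar>I m - I n\<bar> \<le> v m + v n" for m n
  proof -
    have "\<bar>f m \<omega> - f n \<omega>\<bar> \<le> u m + u n" if "\<omega> \<in> \<Omega> - N" for \<omega>
      using abs_diff_triangle[of "f m \<omega>" "f n \<omega>" "g \<omega>"] close[OF that, of m] close[OF that, of n]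
      by (metis abs_minus_commute add_mono order_trans)
    then have "\<bar>I m - I n\<bar> \<le> bprod (u m + u n) (\<mu> \<Omega>)"
      using u0 by (intro integral_difference_le[OF wsd N f f _ _ I I]) auto
    then show ?thesis
      by (simp add: v_def bilinear_ladd[OF bilinear])
  qed
  have cross: "I n - v n \<le> I m + v m" for m n
    using abs_le_D1[OF I_diff[of n m]] by (simp add: algebra_simps)
  define z where "z = (SUP n. I n - v n)"
  have I_close: "\<bar>I n - z\<bar> \<le> v n" for n
  proof (rule abs_leI)
    have "bdd_above (range (\<lambda>n. I n - v n))"
      using cross[of _ 0] by (intro bdd_aboveI2)
    then have "I n - v n \<le> z"
      unfolding z_def by (intro cSUP_upper) auto
    then show "I n - z \<le> v n"
      by (simp add: algebra_simps)
    have "z \<le> I n + v n"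
      unfolding z_def using cross by (intro cSUP_least) auto
    then show "- (I n - z) \<le> v n"
      by (simp add: algebra_simps)
  qed
  have "\<forall>n. \<exists>a. D_sequence a \<and> (\<forall>\<phi>. eventually
      (Riemann_sums_within bprod \<Omega> \<mu> (f n) (I n) (SUP i. a i (\<phi> i))) (refinements M \<Omega>))"
    using I unfolding has_Sstar_integral_iff by (rule allI)
  from choice[OF this] obtain a where a: "\<And>n. D_sequence (a n)"
    and ev: "\<And>n \<phi>. eventually
      (Riemann_sums_within bprod \<Omega> \<mu> (f n) (I n) (SUP i. a n i (\<phi> i))) (refinements M \<Omega>)"
    by blast
  \<comment> \<open>\<open>w\<close> is the estimate that \<open>f 0\<close> gives for the distance to \<open>z\<close>, with the first column of its (D)-sequence.\<close>
  define K where "K = (SUP i. a 0 i 0)"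
  define w where "w = (v 0 + v 0) + K"
  have "0 \<le> a 0 0 0"
    using a[of 0] by (auto simp: D_sequence_def isGlb_UNIV_iff)
  also have "\<dots> \<le> K"
    unfolding K_def using D_sequence_bdd_above[OF a[of 0], of "\<lambda>_. 0"] by (intro cSUP_upper) auto
  finally have w0: "0 \<le> w"
    using v0 by (simp add: w_def)
  have two_v: "decseq (\<lambda>n. v n + v n)" "isGlb UNIV (range (\<lambda>n. v n + v n)) 0"
    using v_dec isGlb_scaleR_two[OF v_glb] by (auto simp: decseq_def scaleR_2 add_mono)
  obtain b where b: "D_sequence b"
    and merge: "\<forall>\<phi>. \<exists>n \<psi>. \<forall>x. x \<le> w \<longrightarrow> x \<le> (v n + v n) + (SUP k. a n k (\<psi> k)) \<longrightarrow>
      x \<le> (SUP i. b i (\<phi> i))"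
    using D_sequence_merge[where a = a, OF a two_v w0] by (elim exE conjE)
  have "eventually (Riemann_sums_within bprod \<Omega> \<mu> g z (SUP i. b i (\<phi> i))) (refinements M \<Omega>)" for \<phi>
  proof -
    obtain n \<psi> where n\<psi>: "\<forall>x. x \<le> w \<longrightarrow> x \<le> (v n + v n) + (SUP k. a n k (\<psi> k)) \<longrightarrow>
        x \<le> (SUP i. b i (\<phi> i))"
      using spec[OF merge, of \<phi>] by (elim exE)
    show ?thesis
      using eventually_refinements_partition eventually_refinements_split[OF N(1)]
        ev[of 0 "\<lambda>_. 0"] ev[of n \<psi>]
    proof eventually_elim
      case (elim P)
      show ?case
        unfolding Riemann_sums_within_def
      proof (intro allI impI)
        fix \<delta> assume \<delta>: "choice_function \<Omega> \<delta>"
        have sum_g: "\<exists>t. has_order_sum (\<lambda>\<alpha>. bprod (g (\<delta> \<alpha>)) (\<mu> \<alpha>)) P t \<and>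
            \<bar>t - z\<bar> \<le> (v k + v k) + B"
          if within: "Riemann_sums_within bprod \<Omega> \<mu> (f k) (I k) B P" for k B
        proof -
          obtain s where s: "has_order_sum (\<lambda>\<alpha>. bprod (f k (\<delta> \<alpha>)) (\<mu> \<alpha>)) P s" "\<bar>s - I k\<bar> \<le> B"
            using within \<delta> unfolding Riemann_sums_within_def by blast
          have "\<bar>g \<omega> - f k \<omega>\<bar> \<le> u k" if "\<omega> \<in> \<Omega> - N" for \<omega>
            using close[OF that] by (simp add: abs_minus_commute)
          from Riemann_sum_close[where h = "f k", OF elim(1,2) N \<delta> g f u0 this s(1)]
          obtain t where t: "has_order_sum (\<lambda>\<alpha>. bprod (g (\<delta> \<alpha>)) (\<mu> \<alpha>)) P t" "\<bar>t - s\<bar> \<le> v k"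
            unfolding v_def by blast
          have "\<bar>t - z\<bar> \<le> \<bar>t - s\<bar> + (\<bar>s - I k\<bar> + \<bar>I k - z\<bar>)"
            using abs_diff_triangle[of t z s] add_left_mono[OF abs_diff_triangle[of s z "I k"]] by (rule order_trans)
          also have "\<dots> \<le> v k + (B + v k)"
            by (intro add_mono t(2) s(2) I_close)
          also have "\<dots> = (v k + v k) + B"
            by (simp add: ac_simps)
          finally show ?thesis
            using t(1) by blast
        qed
        obtain t where t: "has_order_sum (\<lambda>\<alpha>. bprod (g (\<delta> \<alpha>)) (\<mu> \<alpha>)) P t" "\<bar>t - z\<bar> \<le> w"
          using sum_g[OF elim(3)] unfolding w_def K_def by blast
        obtain t' where t': "has_order_sum (\<lambda>\<alpha>. bprod (g (\<delta> \<alpha>)) (\<mu> \<alpha>)) P t'"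
          "\<bar>t' - z\<bar> \<le> (v n + v n) + (SUP k. a n k (\<psi> k))"
          using sum_g[OF elim(4)] by blast
        have "t' = t"
          using order_sum_eq[OF t(1)] order_sum_eq[OF t'(1)] by simp
        then have "\<bar>t - z\<bar> \<le> (SUP i. b i (\<phi> i))"
          using n\<psi> t(2) t'(2) by simp
        with t(1) show "\<exists>t. has_order_sum (\<lambda>\<alpha>. bprod (g (\<delta> \<alpha>)) (\<mu> \<alpha>)) P t \<and>
            \<bar>t - z\<bar> \<le> (SUP i. b i (\<phi> i))"
          by blast
      qed
    qed
  qed
  then have "has_Sstar_integral bprod \<Omega> M \<mu> \<Omega> g z"
    unfolding has_Sstar_integral_iff using b by (intro exI[of _ b] conjI allI)
  with I_close show ?thesis
    unfolding v_def by blast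
qed

end

section \<open>Uniform limits in order\<close>

text \<open>
  The product is assumed to respect suprema of nonnegative sequences, here applied to \<open>u 0 - u n\<close>, which
  increases to \<open>u 0\<close>.
\<close>

lemma (in bilinear_product) isGlb_bprod_left:
  assumes u: "decseq u" "isGlb UNIV (range u) 0" and b: "0 \<le> b"
  shows "isGlb UNIV (range (\<lambda>n. bprod (u n) b)) 0"
proof -
  have "isLub UNIV (range (\<lambda>n. u 0 - u n)) (u 0)"
    using u(2) isGlb_complement_iff[of "u 0" "\<lambda>n. u 0 - u n" UNIV] by simp
  moreover have "0 \<le> u 0 - u n" for n
    using u(1) by (simp add: decseq_def)
  ultimately have "isLub UNIV (range (\<lambda>n. bprod (u 0 - u n) b)) (bprod (u 0) b)"
    by (intro sup_left[OF b])
  then show ?thesis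
    using isGlb_complement_iff[of "bprod (u 0) b" "\<lambda>n. bprod (u 0 - u n) b" UNIV]
    by (simp add: bilinear_lsub[OF bilinear])
qed

theorem theorem4p4:
  fixes \<eta>1 :: "('i::infinite, 'x::archimedean_riesz_space) net_convergence"
    and \<eta>2 :: "('i, 'y::archimedean_riesz_space) net_convergence"
    and \<eta>3 :: "('i, 'z::{archimedean_riesz_space, conditionally_complete_lattice}) net_convergence"
    and bprod :: "'x \<Rightarrow> 'y \<Rightarrow> 'z"
    and \<Omega> :: "'w set" and H :: "'w set set" and \<mu> :: "'w set \<Rightarrow> 'y"
    and f :: "nat \<Rightarrow> 'w \<Rightarrow> 'x" and g :: "'w \<Rightarrow> 'x"
  assumes "locally_solid_convergence \<eta>1"
    and "locally_solid_convergence \<eta>2"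
    and "locally_solid_convergence \<eta>3"
    and "bilinear_product \<eta>1 \<eta>2 \<eta>3 bprod"
    and "weakly_sigma_distributive TYPE('z)"
    and "sigma_algebra \<Omega> H"
    and "\<forall>A\<in>H. 0 \<le> \<mu> A"
    and "sigma_additive \<eta>2 H \<mu>"
    and "\<forall>n. \<forall>\<omega>\<in>\<Omega>. 0 \<le> f n \<omega>"
    and "\<forall>n. Sstar_integrable bprod \<Omega> H \<mu> \<Omega> (f n)"
    and "\<forall>\<omega>\<in>\<Omega>. 0 \<le> g \<omega>"
    and "uniformly_ae_in_order \<Omega> H \<mu> f g"
  shows "Sstar_integrable bprod \<Omega> H \<mu> \<Omega> g \<and>
    order_converges UNIV (\<le>) (\<lambda>n. Sstar_integral bprod \<Omega> H \<mu> \<Omega> (f n))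
      (Sstar_integral bprod \<Omega> H \<mu> \<Omega> g)"
proof -
  interpret product: bilinear_product \<eta>1 \<eta>2 \<eta>3 bprod by fact
  interpret \<eta>2: locally_solid_convergence \<eta>2 by fact
  interpret sigma_algebra \<Omega> H by fact
  interpret positive_additive_measure \<Omega> H bprod \<mu>
  proof
    show "bilinear bprod"
      by (rule product.bilinear)
    show "0 \<le> bprod a b" if "0 \<le> a" "0 \<le> b" for a b
      using product.isotone[of 0 a 0 b] that by (simp add: bilinear_lzero[OF product.bilinear])
    show "0 \<le> \<mu> A" if "A \<in> H" for A
      using assms(7) that by blast
    show "\<mu> (\<Union>C) = sum \<mu> C" if "finite C" "C \<subseteq> H" "disjoint C" for C
      using that assms(8)
      by (intro sigma_additive_imp_additive[OF \<eta>2.hausdorff_vector_convergence_axioms assms(6)])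
  qed
  note wsd = assms(5)
  have f: "0 \<le> f n \<omega>" and g: "0 \<le> g \<omega>" if "\<omega> \<in> \<Omega>" for n \<omega>
    using assms(9,11) that by auto
  obtain N u where N: "N \<in> H" "\<mu> N = 0" and u: "decseq u" "isGlb UNIV (range u) 0"
    and close: "\<And>n \<omega>. \<omega> \<in> \<Omega> - N \<Longrightarrow> \<bar>f n \<omega> - g \<omega>\<bar> \<le> u n"
    using assms(12) unfolding uniformly_ae_in_order_def by blast
  have u0: "0 \<le> u n" for n
    using u(2) by (simp add: isGlb_UNIV_iff)
  define v where "v n = bprod (u n) (\<mu> \<Omega>)" for n
  have v_dec: "decseq v"
    using u(1) bprod_left_mono measure_nonneg[OF top] by (simp add: decseq_def v_def)
  have v_glb: "isGlb UNIV (range v) 0"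
    using product.isGlb_bprod_left[OF u measure_nonneg[OF top]] by (simp add: v_def[abs_def])
  obtain I where I: "\<And>n. has_Sstar_integral bprod \<Omega> H \<mu> \<Omega> (f n) (I n)"
    using assms(10) unfolding Sstar_integrable_def by metis
  obtain z where z: "has_Sstar_integral bprod \<Omega> H \<mu> \<Omega> g z" "\<And>n. \<bar>I n - z\<bar> \<le> v n"
    using has_Sstar_integral_uniform_limit[where f = f and u = u and I = I,
        OF wsd N f g u0 close v_dec[unfolded v_def[abs_def]] v_glb[unfolded v_def[abs_def]] I]
    unfolding v_def by blast
  have "Sstar_integral bprod \<Omega> H \<mu> \<Omega> h = y"
    if "has_Sstar_integral bprod \<Omega> H \<mu> \<Omega> h y" "\<And>\<omega>. \<omega> \<in> \<Omega> \<Longrightarrow> 0 \<le> h \<omega>" for h y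
    unfolding Sstar_integral_def
    using that has_Sstar_integral_unique[OF wsd that(2)] by (intro the_equality) auto
  then have integral: "Sstar_integral bprod \<Omega> H \<mu> \<Omega> g = z" "\<And>n. Sstar_integral bprod \<Omega> H \<mu> \<Omega> (f n) = I n"
    using z(1) I f g by blast+
  have "order_converges UNIV (\<le>) I z"
  proof (rule order_converges_if_dominated[where e = v])
    show "directed_set (UNIV :: nat set) (\<le>)"
      by (auto simp: directed_set_def reflp_on_def transp_on_def intro: max.cobounded1 max.cobounded2)
    show "v j \<le> v i" if "i \<le> j" for i j
      using v_dec that by (simp add: decseq_def)
  qed (use v_glb z(2) in auto)
  then show ?thesis
    using z(1) integral by (auto simp: Sstar_integrable_def)
qed

end
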